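(* Let $n\ge2$ and let $\mathcal{W}$ be a Hilbert space. Let $(M_{\Phi_1},\ldots,M_{\Phi_n})$ be a model $n$-isometry on $H^2_{\mathcal{W}}(\mathbb{D})$, and let $\mathcal{S}$ be a closed subspace of $H^2_{\mathcal{W}}(\mathbb{D})$. Then $\mathcal{S}$ is invariant for $(M_{\Phi_1},\ldots,M_{\Phi_n})$ (that is, $M_{\Phi_i}\mathcal{S}\subseteq\mathcal{S}$ for all $i=1,\ldots,n$) if and only if there exist a Hilbert space $\mathcal{W}_*$, an inner function $\Theta\in H^\infty_{\mathcal{B}(\mathcal{W}_*,\mathcal{W})}(\mathbb{D})$ and a model $n$-isometry $(M_{\Psi_1},\ldots,M_{\Psi_n})$ on $H^2_{\mathcal{W}_*}(\mathbb{D})$ such that \[ \mathcal{S}=\Theta H^2_{\mathcal{W}_*}(\mathbb{D}) \] and \[ \Phi_j\Theta=\Theta\Psi_j \] for all $j=1,\ldots,n$.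
   Context: For Hilbert spaces $\mathcal{E},\mathcal{F}$, $H^2_{\mathcal{E}}(\mathbb{D})$ is the $\mathcal{E}$-valued Hardy space on the unit disc, $H^\infty_{\mathcal{B}(\mathcal{E},\mathcal{F})}(\mathbb{D})$ is the space of bounded $\mathcal{B}(\mathcal{E},\mathcal{F})$-valued holomorphic functions on $\mathbb{D}$, and $M_\Theta:H^2_{\mathcal{E}}(\mathbb{D})\to H^2_{\mathcal{F}}(\mathbb{D})$ is multiplication by $\Theta$; $\Theta$ is inner if $M_\Theta$ is an isometry (equivalently, its boundary values are isometries a.e. on the unit circle). Hilbert spaces are allowed to be $\{0\}$. Model $n$-isometry: let $\mathcal{E}$ be a Hilbert space, $U_1,\ldots,U_n$ unitary operators on $\mathcal{E}$ and $P_1,\ldots,P_n$ orthogonal projections on $\mathcal{E}$ (with $P_i^\perp=I_{\mathcal{E}}-P_i$), and put $\Phi_i(z)=U_i(P_i^\perp+zP_i)$, $z\in\mathbb{D}$. The tuple $(M_{\Phi_1},\ldots,M_{\Phi_n})$ on $H^2_{\mathcal{E}}(\mathbb{D})$ is a model $n$-isometry if: (a) $U_iU_j=U_jU_i$ for all $i,j$; (b) $U_1\cdots U_n=I_{\mathcal{E}}$; (c) $P_i+U_i^*P_jU_i=P_j+U_j^*P_iU_j\le I_{\mathcal{E}}$ for all $i\ne j$; (d) $P_1+U_1^*P_2U_1+U_1^*U_2^*P_3U_2U_1+\cdots+U_1^*U_2^*\cdots U_{n-1}^*P_nU_{n-1}\cdots U_2U_1=I_{\mathcal{E}}$. *)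

theory Defs
  imports "HOL-Analysis.Analysis" "HOL-Library.Complex_Order"
begin

section \<open>Complex Hilbert spaces\<close>

class complex_vector = real_vector +
  fixes scaleC :: "complex \<Rightarrow> 'a \<Rightarrow> 'a"  (infixr "*\<^sub>C" 75)
  assumes scaleC_add_right: "c *\<^sub>C (x + y) = c *\<^sub>C x + c *\<^sub>C y"
    and scaleC_add_left: "(c + d) *\<^sub>C x = c *\<^sub>C x + d *\<^sub>C x"
    and scaleC_scaleC: "c *\<^sub>C d *\<^sub>C x = (c * d) *\<^sub>C x"
    and scaleR_scaleC: "r *\<^sub>R x = complex_of_real r *\<^sub>C x"

text \<open>The complex inner product is linear in its first argument; the real inner product
  of the library, which determines norm and topology, is its real part.\<close>

class complex_inner = complex_vector + real_inner +
  fixes cinner :: "'a \<Rightarrow> 'a \<Rightarrow> complex"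
  assumes cinner_commute: "cinner x y = cnj (cinner y x)"
    and cinner_add_left: "cinner (x + y) w = cinner x w + cinner y w"
    and cinner_scaleC_left: "cinner (c *\<^sub>C x) y = c * cinner x y"
    and inner_eq_Re_cinner: "inner x y = Re (cinner x y)"

class chilbert_space = complex_inner + banach

instantiation complex :: chilbert_space
begin

definition scaleC_complex :: "complex \<Rightarrow> complex \<Rightarrow> complex" where
  "scaleC_complex c x = c * x"

definition cinner_complex :: "complex \<Rightarrow> complex \<Rightarrow> complex" where
  "cinner_complex x y = x * cnj y"

instance
  by standard (auto simp: scaleC_complex_def cinner_complex_def inner_complex_def algebra_simps
      complex_eq_iff)

end

lemma scaleC_one [simp]: "1 *\<^sub>C x = (x :: 'a::complex_vector)"
  using scaleR_scaleC[of 1 x] by simp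

lemma scaleC_zero_left [simp]: "0 *\<^sub>C x = (0 :: 'a::complex_vector)"
  using scaleR_scaleC[of 0 x] by simp

lemma scaleC_zero_right [simp]: "c *\<^sub>C 0 = (0 :: 'a::complex_vector)"
  using scaleC_add_right[of c 0 0] by simp

lemma scaleC_scaleR_commute: "c *\<^sub>C (r *\<^sub>R x) = r *\<^sub>R (c *\<^sub>C (x :: 'a::complex_vector))"
  by (simp add: scaleR_scaleC scaleC_scaleC mult.commute)

lemma cinner_add_right: "cinner w (x + y) = cinner w x + cinner w (y :: 'a::complex_inner)"
  by (metis cinner_commute cinner_add_left complex_cnj_add)

lemma cinner_scaleC_right: "cinner x (c *\<^sub>C y) = cnj c * cinner x (y :: 'a::complex_inner)"
  by (metis cinner_commute cinner_scaleC_left complex_cnj_mult)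

lemma cinner_self: "cinner x x = complex_of_real ((norm (x :: 'a::complex_inner))\<^sup>2)"
proof -
  have "Im (cinner x x) = 0"
    using arg_cong[OF cinner_commute[of x x], of Im] by simp
  moreover have "Re (cinner x x) = (norm x)\<^sup>2"
    by (simp add: power2_norm_eq_inner inner_eq_Re_cinner)
  ultimately show ?thesis by (simp add: complex_eq_iff)
qed

lemma norm_scaleC: "norm (c *\<^sub>C x) = cmod c * norm (x :: 'a::complex_inner)"
proof -
  have "complex_of_real ((norm (c *\<^sub>C x))\<^sup>2) = c * cnj c * complex_of_real ((norm x)\<^sup>2)"
    unfolding cinner_self[symmetric] cinner_scaleC_left cinner_scaleC_right by (simp only: mult_ac)
  also have "\<dots> = complex_of_real ((cmod c * norm x)\<^sup>2)"
    by (simp add: complex_norm_square[symmetric] power_mult_distrib)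
  finally have "(norm (c *\<^sub>C x))\<^sup>2 = (cmod c * norm x)\<^sup>2"
    by (simp only: of_real_eq_iff)
  thus ?thesis by (simp add: power2_eq_iff_nonneg)
qed

lemma bounded_linear_scaleC: "bounded_linear (\<lambda>x :: 'a::complex_inner. c *\<^sub>C x)"
  by (rule bounded_linear_intro[where K = "cmod c"])
    (simp_all add: scaleC_add_right scaleC_scaleR_commute norm_scaleC)

text \<open>A Cauchy-Schwarz estimate sufficient for the convergence of the series below.\<close>

lemma cmod_cinner_le: "cmod (cinner x y) \<le> norm x * norm (y :: 'a::complex_inner)"
proof (cases "cinner x y = 0")
  case False
  define u where "u = cnj (cinner x y) / complex_of_real (cmod (cinner x y))"
  have "cinner (u *\<^sub>C x) y = complex_of_real (cmod (cinner x y))"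
    using False unfolding u_def cinner_scaleC_left
    by (simp add: complex_norm_square[symmetric] power2_eq_square mult.commute[of "cnj _"])
  hence "inner (u *\<^sub>C x) y = cmod (cinner x y)" by (simp add: inner_eq_Re_cinner)
  moreover have "cmod u = 1" using False by (simp add: u_def norm_divide)
  ultimately show ?thesis
    using norm_cauchy_schwarz[of "u *\<^sub>C x" y] by (simp add: norm_scaleC)
qed simp

section \<open>The Hardy space\<close>

definition unit_disc :: "complex set" where
  "unit_disc = ball 0 1"

lemma unit_disc_iff: "z \<in> unit_disc \<longleftrightarrow> cmod z < 1"
  by (simp add: unit_disc_def)

definition square_summable :: "(nat \<Rightarrow> 'a::real_normed_vector) \<Rightarrow> bool" where
  "square_summable a \<longleftrightarrow> summable (\<lambda>n. (norm (a n))\<^sup>2)"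

text \<open>Functions on the disc are total functions on \<^typ>\<open>complex\<close> that vanish off the disc.\<close>

definition disc_series :: "(nat \<Rightarrow> 'a::chilbert_space) \<Rightarrow> complex \<Rightarrow> 'a" where
  "disc_series a z = (if z \<in> unit_disc then (\<Sum>n. z ^ n *\<^sub>C a n) else 0)"

text \<open>The type \<open>'a hardy\<close> is the Hardy space of all \<open>f(z) = \<Sum>n. z ^ n *\<^sub>C a n\<close> on the disc
  with \<open>\<Sum>n. (norm (a n))\<^sup>2\<close> finite, the latter being the square of the norm of \<open>f\<close>.\<close>

typedef (overloaded) 'a hardy =
    "{f :: complex \<Rightarrow> 'a::chilbert_space. \<exists>a. square_summable a \<and> f = disc_series a}"
  morphisms hardy_eval Abs_hardy
proof
  show "disc_series (\<lambda>_. 0) \<in> {f :: complex \<Rightarrow> 'a. \<exists>a. square_summable a \<and> f = disc_series a}"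
    by (auto simp: square_summable_def intro!: exI[of _ "\<lambda>_. 0"])
qed

definition hardy_coeff :: "'a::chilbert_space hardy \<Rightarrow> nat \<Rightarrow> 'a" where
  "hardy_coeff f = (THE a. square_summable a \<and> hardy_eval f = disc_series a)"

lemma square_summable_add:
  assumes "square_summable a" "square_summable b"
  shows "square_summable (\<lambda>n. a n + b n)"
  unfolding square_summable_def
proof (rule summable_comparison_test')
  show "summable (\<lambda>n. 2 * (norm (a n))\<^sup>2 + 2 * (norm (b n))\<^sup>2)"
    using assms unfolding square_summable_def by (intro summable_add summable_mult)
  fix n :: nat
  have "(norm (a n + b n))\<^sup>2 \<le> (norm (a n) + norm (b n))\<^sup>2"
    by (intro power_mono norm_triangle_ineq) simp
  also have "\<dots> \<le> 2 * (norm (a n))\<^sup>2 + 2 * (norm (b n))\<^sup>2"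
    using zero_le_power2[of "norm (a n) - norm (b n)"] by (simp add: power2_eq_square algebra_simps)
  finally show "norm ((norm (a n + b n))\<^sup>2) \<le> 2 * (norm (a n))\<^sup>2 + 2 * (norm (b n))\<^sup>2"
    by simp
qed

lemma square_summable_scaleC:
  assumes "square_summable (a :: nat \<Rightarrow> 'a::complex_inner)"
  shows "square_summable (\<lambda>n. c *\<^sub>C a n)"
  using summable_mult[OF assms[unfolded square_summable_def], of "(cmod c)\<^sup>2"]
  by (simp add: square_summable_def norm_scaleC power_mult_distrib)

lemma square_summable_mult:
  assumes "square_summable a" "square_summable b"
  shows "summable (\<lambda>n. norm (a n) * norm (b n))"
proof (rule summable_comparison_test')
  show "summable (\<lambda>n. (norm (a n))\<^sup>2 + (norm (b n))\<^sup>2)"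
    using assms unfolding square_summable_def by (intro summable_add)
  fix n :: nat
  have "2 * (norm (a n) * norm (b n)) \<le> (norm (a n))\<^sup>2 + (norm (b n))\<^sup>2"
    using zero_le_power2[of "norm (a n) - norm (b n)"] by (simp add: power2_eq_square algebra_simps)
  moreover have "0 \<le> norm (a n) * norm (b n)" by simp
  ultimately show "norm (norm (a n) * norm (b n)) \<le> (norm (a n))\<^sup>2 + (norm (b n))\<^sup>2"
    by (smt (verit) norm_ge_zero real_norm_def)
qed

lemma summable_disc_series:
  assumes "square_summable (a :: nat \<Rightarrow> 'a::chilbert_space)" "cmod z < 1"
  shows "summable (\<lambda>n. z ^ n *\<^sub>C a n)"
proof (rule summable_norm_cancel)
  have "(cmod z)\<^sup>2 < 1" using assms(2) by (simp add: abs_square_less_1)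
  hence "square_summable (\<lambda>n. z ^ n)"
    using summable_geometric[of "(cmod z)\<^sup>2"]
    by (simp add: square_summable_def norm_power power_mult[symmetric] mult.commute)
  from square_summable_mult[OF this assms(1)]
  show "summable (\<lambda>n. norm (z ^ n *\<^sub>C a n))" by (simp add: norm_scaleC)
qed

lemma disc_series_add:
  assumes "square_summable a" "square_summable b"
  shows "disc_series (\<lambda>n. a n + b n) z = disc_series a z + disc_series b z"
  using assms by (auto simp: disc_series_def scaleC_add_right unit_disc_iff
      intro!: suminf_add[symmetric] summable_disc_series)

lemma disc_series_scaleC:
  assumes "square_summable a"
  shows "disc_series (\<lambda>n. c *\<^sub>C a n) z = c *\<^sub>C disc_series a z"
  using bounded_linear.suminf[OF bounded_linear_scaleC summable_disc_series[OF assms], of z c]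
  by (auto simp: disc_series_def scaleC_scaleC unit_disc_iff mult.commute)

lemma real_power_series_zero:
  fixes c :: "nat \<Rightarrow> real"
  assumes "\<And>x. \<bar>x\<bar> < 1 \<Longrightarrow> (\<lambda>n. c n * x ^ n) sums 0"
  shows "c m = 0"
proof (induction m rule: less_induct)
  case (less m)
  have "(\<lambda>n. c (n + m) * x ^ n) sums 0" if "x \<noteq> 0" "norm x < 1" for x
  proof -
    have "(\<lambda>n. c (n + m) * x ^ (n + m)) sums 0"
      using assms[of x] that less sums_zero_iff_shift[of m "\<lambda>n. c n * x ^ n" 0] by simp
    from sums_mult[OF this, of "1 / x ^ m"] show ?thesis
      using that by (simp add: power_add field_simps)
  qed
  from powser_limit_0_strong[of 1 "\<lambda>n. c (n + m)" "\<lambda>_. 0", OF _ this]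
  have "((\<lambda>_. 0) \<longlongrightarrow> c m) (at (0::real))" by simp
  thus ?case using tendsto_unique[of "at (0::real)"] by (metis at_neq_bot tendsto_const)
qed

lemma disc_series_inject:
  assumes a: "square_summable a" and b: "square_summable b" and eq: "disc_series a = disc_series b"
  shows "a = (b :: nat \<Rightarrow> 'a::chilbert_space)"
proof
  fix m
  define d where "d n = a n + (-1) *\<^sub>C b n" for n
  have m1: "(-1) *\<^sub>C x = - x" for x :: 'a
    using scaleR_scaleC[of "-1" x] by simp
  have d: "square_summable d"
    unfolding d_def by (intro square_summable_add square_summable_scaleC a b)
  have "disc_series d z = disc_series a z + (-1) *\<^sub>C disc_series b z" for z
    unfolding d_def
    by (subst disc_series_add[OF a square_summable_scaleC[OF b]]) (simp add: disc_series_scaleC[OF b])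
  hence d0: "disc_series d z = 0" for z by (simp add: eq m1)
  have "inner (d m) (d m) = 0"
  proof (rule real_power_series_zero[where c = "\<lambda>n. inner (d n) (d m)"])
    fix x :: real assume x: "\<bar>x\<bar> < 1"
    have s: "summable (\<lambda>n. complex_of_real x ^ n *\<^sub>C d n)"
      using x by (intro summable_disc_series[OF d]) simp
    have "(\<lambda>n. complex_of_real x ^ n *\<^sub>C d n) sums disc_series d (complex_of_real x)"
      using x s by (simp add: disc_series_def unit_disc_iff summable_sums)
    hence "(\<lambda>n. x ^ n *\<^sub>R d n) sums 0"
      by (simp add: d0 scaleR_scaleC)
    from bounded_linear.sums[OF bounded_linear_inner_left this, of "d m"]
    show "(\<lambda>n. inner (d n) (d m) * x ^ n) sums 0" by (simp add: mult.commute)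
  qed
  thus "a m = b m" by (simp add: d_def m1)
qed

lemma hardy_coeff_unique:
  assumes "square_summable a" "hardy_eval f = disc_series a"
  shows "hardy_coeff f = a"
  unfolding hardy_coeff_def using assms by (intro the_equality) (auto intro: disc_series_inject)

lemma hardy_coeff:
  shows square_summable_hardy_coeff: "square_summable (hardy_coeff f)"
    and hardy_eval_coeff: "hardy_eval f = disc_series (hardy_coeff f)"
proof -
  from hardy_eval[of f] obtain a where a: "square_summable a" "hardy_eval f = disc_series a"
    by auto
  with hardy_coeff_unique[OF this] show "square_summable (hardy_coeff f)"
    "hardy_eval f = disc_series (hardy_coeff f)" by simp_all
qed

lemma hardy_eqI: "(\<And>n. hardy_coeff f n = hardy_coeff g n) \<Longrightarrow> f = g"
  by (metis ext hardy_eval_coeff hardy_eval_inject)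

lemma Abs_hardy_series:
  assumes "square_summable a"
  shows "hardy_eval (Abs_hardy (disc_series a)) = disc_series a"
    and "hardy_coeff (Abs_hardy (disc_series a)) = a"
proof -
  show "hardy_eval (Abs_hardy (disc_series a)) = disc_series a"
    using assms by (intro Abs_hardy_inverse) blast
  with assms show "hardy_coeff (Abs_hardy (disc_series a)) = a"
    by (rule hardy_coeff_unique)
qed

instantiation hardy :: (chilbert_space) complex_vector
begin

definition "0 = Abs_hardy (\<lambda>_. 0)"
definition "f + g = Abs_hardy (\<lambda>z. hardy_eval f z + hardy_eval g z)"
definition "c *\<^sub>C f = Abs_hardy (\<lambda>z. c *\<^sub>C hardy_eval f z)"
definition "r *\<^sub>R (f :: 'a hardy) = complex_of_real r *\<^sub>C f"
definition "- (f :: 'a hardy) = (-1) *\<^sub>C f"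
definition "f - (g :: 'a hardy) = f + (- g)"

lemma coeff_add: "hardy_coeff (f + g) n = hardy_coeff f n + hardy_coeff (g :: 'a hardy) n"
proof -
  have "f + g = Abs_hardy (disc_series (\<lambda>n. hardy_coeff f n + hardy_coeff g n))"
    unfolding plus_hardy_def
    by (intro arg_cong[where f = Abs_hardy] ext)
      (simp add: disc_series_add square_summable_hardy_coeff hardy_eval_coeff)
  thus ?thesis by (simp add: Abs_hardy_series square_summable_add square_summable_hardy_coeff)
qed

lemma coeff_scaleC: "hardy_coeff (c *\<^sub>C f) n = c *\<^sub>C hardy_coeff (f :: 'a hardy) n"
proof -
  have "c *\<^sub>C f = Abs_hardy (disc_series (\<lambda>n. c *\<^sub>C hardy_coeff f n))"
    unfolding scaleC_hardy_def
    by (intro arg_cong[where f = Abs_hardy] ext)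
      (simp add: disc_series_scaleC square_summable_hardy_coeff hardy_eval_coeff)
  thus ?thesis by (simp add: Abs_hardy_series square_summable_scaleC square_summable_hardy_coeff)
qed

lemma coeff_zero: "hardy_coeff (0 :: 'a hardy) n = 0"
proof -
  have "(0 :: 'a hardy) = Abs_hardy (disc_series (\<lambda>_. 0))"
    unfolding zero_hardy_def by (intro arg_cong[where f = Abs_hardy] ext) (simp add: disc_series_def)
  moreover have "square_summable (\<lambda>_::nat. 0 :: 'a)" by (simp add: square_summable_def)
  ultimately show ?thesis by (metis Abs_hardy_series(2))
qed

lemma coeff_scaleR: "hardy_coeff (r *\<^sub>R f) n = r *\<^sub>R hardy_coeff (f :: 'a hardy) n"
  by (simp add: scaleR_hardy_def coeff_scaleC scaleR_scaleC)

lemma coeff_uminus: "hardy_coeff (- f) n = - hardy_coeff (f :: 'a hardy) n"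
  using scaleR_scaleC[of "-1" "hardy_coeff f n"] by (simp add: uminus_hardy_def coeff_scaleC)

lemma coeff_diff: "hardy_coeff (f - g) n = hardy_coeff f n - hardy_coeff (g :: 'a hardy) n"
  by (simp add: minus_hardy_def coeff_add coeff_uminus)

lemmas hardy_coeff_simps =
  coeff_add coeff_scaleC coeff_zero coeff_scaleR coeff_uminus coeff_diff

instance
proof
  fix f g h :: "'a hardy" and c d :: complex and r s :: real
  show "f + g + h = f + (g + h)" "f + g = g + f" "0 + f = f" "- f + f = 0" "f - g = f + - g"
    "r *\<^sub>R (f + g) = r *\<^sub>R f + r *\<^sub>R g" "(r + s) *\<^sub>R f = r *\<^sub>R f + s *\<^sub>R f"
    "r *\<^sub>R s *\<^sub>R f = (r * s) *\<^sub>R f" "1 *\<^sub>R f = f"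
    by (rule hardy_eqI, simp add: hardy_coeff_simps algebra_simps)+
  show "c *\<^sub>C (f + g) = c *\<^sub>C f + c *\<^sub>C g" "(c + d) *\<^sub>C f = c *\<^sub>C f + d *\<^sub>C f"
    "c *\<^sub>C d *\<^sub>C f = (c * d) *\<^sub>C f"
    by (rule hardy_eqI, simp add: hardy_coeff_simps scaleC_add_right scaleC_add_left scaleC_scaleC)+
  show "r *\<^sub>R f = complex_of_real r *\<^sub>C f" by (rule scaleR_hardy_def)
qed

end

instantiation hardy :: (chilbert_space) complex_inner
begin

definition "cinner f g = (\<Sum>n. cinner (hardy_coeff f n) (hardy_coeff g n))"
definition "inner f (g :: 'a hardy) = Re (cinner f g)"
definition "norm f = sqrt (\<Sum>n. (norm (hardy_coeff f n))\<^sup>2)"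
definition "dist f (g :: 'a hardy) = norm (f - g)"
definition "sgn (f :: 'a hardy) = inverse (norm f) *\<^sub>R f"
definition [code del]:
  "(uniformity :: ('a hardy \<times> 'a hardy) filter) = (INF e\<in>{0<..}. principal {(x, y). dist x y < e})"
definition [code del]:
  "open (A :: 'a hardy set) \<longleftrightarrow> (\<forall>x\<in>A. eventually (\<lambda>(x', y). x' = x \<longrightarrow> y \<in> A) uniformity)"

lemma summable_coeff: "summable (\<lambda>n. (norm (hardy_coeff (f :: 'a hardy) n))\<^sup>2)"
  using square_summable_hardy_coeff[of f] by (simp add: square_summable_def)

lemma summable_cinner_coeff:
  "summable (\<lambda>n. cinner (hardy_coeff f n) (hardy_coeff (g :: 'a hardy) n))"
  by (rule summable_comparison_test'[OF square_summable_mult[OF square_summable_hardy_coeff[of f]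
          square_summable_hardy_coeff[of g]]]) (simp add: cmod_cinner_le)

lemma cinner_self_hardy: "cinner f f = complex_of_real (\<Sum>n. (norm (hardy_coeff (f :: 'a hardy) n))\<^sup>2)"
  by (simp add: cinner_hardy_def cinner_self suminf_of_real[OF summable_coeff])

instance
proof
  fix f g h :: "'a hardy" and c :: complex and r :: real
  show "dist f g = norm (f - g)" by (rule dist_hardy_def)
  show "sgn f = f /\<^sub>R norm f" by (rule sgn_hardy_def)
  show "(uniformity :: ('a hardy \<times> 'a hardy) filter)
      = (INF e\<in>{0<..}. principal {(x, y). dist x y < e})"
    by (rule uniformity_hardy_def)
  show "open A \<longleftrightarrow> (\<forall>x\<in>A. \<forall>\<^sub>F (x', y) in uniformity. x' = x \<longrightarrow> y \<in> A)" for A :: "'a hardy set"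
    by (rule open_hardy_def)
  show comm: "cinner f g = cnj (cinner g f)" for f g :: "'a hardy"
    using bounded_linear.suminf[OF bounded_linear_cnj summable_cinner_coeff, of g f]
    by (simp add: cinner_hardy_def cinner_commute[symmetric])
  show add: "cinner (f + g) h = cinner f h + cinner g h"
    using suminf_add[OF summable_cinner_coeff[of f h] summable_cinner_coeff[of g h]]
    by (simp add: cinner_hardy_def coeff_add cinner_add_left)
  show sc: "cinner (c *\<^sub>C f) g = c * cinner f g" for c
    using suminf_mult[OF summable_cinner_coeff[of f g], of c]
    by (simp add: cinner_hardy_def coeff_scaleC cinner_scaleC_left)
  show "inner f g = Re (cinner f g)" by (rule inner_hardy_def)
  show "inner f g = inner g f" using comm[of f g] by (simp add: inner_hardy_def)
  show "inner (f + g) h = inner f h + inner g h" by (simp add: inner_hardy_def add)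
  show "inner (r *\<^sub>R f) g = r * inner f g" by (simp add: inner_hardy_def scaleR_hardy_def sc)
  show "0 \<le> inner f f"
    by (simp add: inner_hardy_def cinner_self_hardy suminf_nonneg summable_coeff)
  show "inner f f = 0 \<longleftrightarrow> f = 0"
    using suminf_eq_zero_iff[OF summable_coeff[of f]]
    by (auto simp: inner_hardy_def cinner_self_hardy coeff_zero intro: hardy_eqI)
  show "norm f = sqrt (inner f f)"
    by (simp add: norm_hardy_def inner_hardy_def cinner_self_hardy)
qed

end

instance hardy :: (chilbert_space) chilbert_space
proof
  fix X :: "nat \<Rightarrow> 'a hardy"
  assume "Cauchy X"
  have norm2: "(norm f)\<^sup>2 = (\<Sum>n. (norm (hardy_coeff f n))\<^sup>2)" for f :: "'a hardy"
    by (simp add: norm_hardy_def suminf_nonneg summable_coeff)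
  have partial: "(\<Sum>n<N. (norm (hardy_coeff f n))\<^sup>2) \<le> (norm f)\<^sup>2" for f :: "'a hardy" and N
    unfolding norm2 by (intro sum_le_suminf summable_coeff) auto
  have Cau: "\<exists>M. \<forall>m\<ge>M. \<forall>n\<ge>M. norm (X m - X n) < e" if "e > 0" for e
    using \<open>Cauchy X\<close> that by (auto simp: Cauchy_def dist_norm)
  have coord: "norm (hardy_coeff f n) \<le> norm f" for f :: "'a hardy" and n
  proof (rule power2_le_imp_le[OF _ norm_ge_zero])
    have "(norm (hardy_coeff f n))\<^sup>2 \<le> (\<Sum>n<Suc n. (norm (hardy_coeff f n))\<^sup>2)"
      by (simp add: sum_nonneg)
    thus "(norm (hardy_coeff f n))\<^sup>2 \<le> (norm f)\<^sup>2" using partial[where N = "Suc n" and f = f] by linarith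
  qed
  have "Cauchy (\<lambda>k. hardy_coeff (X k) n)" for n
  proof (rule CauchyI)
    fix e :: real assume "e > 0"
    then obtain M where M: "\<forall>m\<ge>M. \<forall>n\<ge>M. norm (X m - X n) < e" using Cau by blast
    thus "\<exists>M. \<forall>m\<ge>M. \<forall>k\<ge>M. norm (hardy_coeff (X m) n - hardy_coeff (X k) n) < e"
      using coord[where n = n] by (metis coeff_diff le_less_trans)
  qed
  hence "\<exists>l. (\<lambda>k. hardy_coeff (X k) n) \<longlonglongrightarrow> l" for n
    by (simp add: Cauchy_convergent_iff convergent_def)
  then obtain a where a: "(\<lambda>k. hardy_coeff (X k) n) \<longlonglongrightarrow> a n" for n by metis
  have est: "\<exists>M. \<forall>m\<ge>M. \<forall>N. (\<Sum>n<N. (norm (hardy_coeff (X m) n - a n))\<^sup>2) \<le> e\<^sup>2" if "e > 0" for e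
  proof -
    obtain M where M: "\<forall>m\<ge>M. \<forall>n\<ge>M. norm (X m - X n) < e" using Cau[OF \<open>e > 0\<close>] by blast
    have "(\<Sum>n<N. (norm (hardy_coeff (X m) n - a n))\<^sup>2) \<le> e\<^sup>2" if m: "m \<ge> M" for m N
    proof (rule tendsto_upperbound)
      show "(\<lambda>k. \<Sum>n<N. (norm (hardy_coeff (X m) n - hardy_coeff (X k) n))\<^sup>2)
          \<longlonglongrightarrow> (\<Sum>n<N. (norm (hardy_coeff (X m) n - a n))\<^sup>2)"
        by (intro tendsto_intros a)
      show "\<forall>\<^sub>F k in sequentially. (\<Sum>n<N. (norm (hardy_coeff (X m) n - hardy_coeff (X k) n))\<^sup>2) \<le> e\<^sup>2"
        using eventually_ge_at_top[of M]
      proof eventually_elim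
        case (elim k)
        have "(\<Sum>n<N. (norm (hardy_coeff (X m) n - hardy_coeff (X k) n))\<^sup>2) \<le> (norm (X m - X k))\<^sup>2"
          using partial[where N = N and f = "X m - X k"] by (simp add: coeff_diff)
        also have "\<dots> \<le> e\<^sup>2" using M m elim by (meson less_imp_le norm_ge_zero power_mono)
        finally show ?case .
      qed
    qed simp
    thus ?thesis by blast
  qed
  have diff_ss: "square_summable (\<lambda>n. hardy_coeff (X m) n - a n)"
    if "\<forall>N. (\<Sum>n<N. (norm (hardy_coeff (X m) n - a n))\<^sup>2) \<le> e\<^sup>2" for m e
    unfolding square_summable_def using that
    by (intro summableI_nonneg_bounded[where x = "e\<^sup>2"]) auto
  obtain M where "\<forall>N. (\<Sum>n<N. (norm (hardy_coeff (X M) n - a n))\<^sup>2) \<le> 1\<^sup>2" using est[of 1] by auto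
  from square_summable_add[OF square_summable_hardy_coeff[of "X M"]
      square_summable_scaleC[OF diff_ss[OF this], of "-1"]]
  have a_ss: "square_summable a"
    using scaleR_scaleC[of "-1" "hardy_coeff (X M) _ - a _", symmetric] by simp
  define L where "L = Abs_hardy (disc_series a)"
  have L: "hardy_coeff L = a" by (simp add: L_def Abs_hardy_series a_ss)
  have "\<exists>M. \<forall>m\<ge>M. dist (X m) L < e" if e: "e > 0" for e
  proof -
    obtain M where M: "\<And>m N. m \<ge> M \<Longrightarrow> (\<Sum>n<N. (norm (hardy_coeff (X m) n - a n))\<^sup>2) \<le> (e/2)\<^sup>2"
      using est[of "e/2"] e by auto
    have "dist (X m) L < e" if m: "m \<ge> M" for m
    proof -
      have "(norm (X m - L))\<^sup>2 \<le> (e/2)\<^sup>2"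
        unfolding norm2 coeff_diff L using M[OF m] diff_ss[of m "e/2"]
        by (intro suminf_le_const) (auto simp: square_summable_def)
      hence "norm (X m - L) \<le> e/2" by (rule power2_le_imp_le) (use e in simp)
      thus ?thesis using e by (simp add: dist_norm)
    qed
    thus ?thesis by blast
  qed
  hence "X \<longlonglongrightarrow> L" unfolding lim_sequentially by blast
  thus "convergent X" by (rule convergentI)
qed

section \<open>Operators between Hilbert spaces\<close>

text \<open>A Hilbert space is represented by a closed complex subspace of a type of class
  \<^class>\<open>chilbert_space\<close>, and an operator on it by a function on the ambient type of which
  only the values on that subspace matter.\<close>

definition closed_csubspace :: "'a::complex_inner set \<Rightarrow> bool" where
  "closed_csubspace E \<longleftrightarrow> closed E \<and> 0 \<in> E \<and> (\<forall>x\<in>E. \<forall>y\<in>E. x + y \<in> E) \<and> (\<forall>c. \<forall>x\<in>E. c *\<^sub>C x \<in> E)"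

definition bounded_ops :: "'a::complex_inner set \<Rightarrow> 'b::complex_inner set \<Rightarrow> ('a \<Rightarrow> 'b) set" where
  "bounded_ops E F = {T. (\<forall>x\<in>E. T x \<in> F) \<and> (\<forall>x\<in>E. \<forall>y\<in>E. T (x + y) = T x + T y) \<and>
     (\<forall>c. \<forall>x\<in>E. T (c *\<^sub>C x) = c *\<^sub>C T x) \<and> (\<exists>K. \<forall>x\<in>E. norm (T x) \<le> K * norm x)}"

definition op_norm :: "'a::complex_inner set \<Rightarrow> ('a \<Rightarrow> 'b::complex_inner) \<Rightarrow> real" where
  "op_norm E T = (SUP x\<in>{x\<in>E. norm x \<le> 1}. norm (T x))"

definition adj :: "'a::complex_inner set \<Rightarrow> ('a \<Rightarrow> 'a) \<Rightarrow> 'a \<Rightarrow> 'a" where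
  "adj E T y = (THE w. w \<in> E \<and> (\<forall>x\<in>E. cinner (T x) y = cinner x w))"

definition unitary_on :: "'a::complex_inner set \<Rightarrow> ('a \<Rightarrow> 'a) \<Rightarrow> bool" where
  "unitary_on E U \<longleftrightarrow> U \<in> bounded_ops E E \<and> (\<forall>x\<in>E. adj E U (U x) = x \<and> U (adj E U x) = x)"

definition orth_proj_on :: "'a::complex_inner set \<Rightarrow> ('a \<Rightarrow> 'a) \<Rightarrow> bool" where
  "orth_proj_on E P \<longleftrightarrow> P \<in> bounded_ops E E \<and> (\<forall>x\<in>E. P (P x) = P x \<and> adj E P x = P x)"

text \<open>The operator order; \<open>0 \<le> c\<close> for complex \<open>c\<close> means that \<open>c\<close> is real and nonnegative.\<close>

definition op_le :: "'a::complex_inner set \<Rightarrow> ('a \<Rightarrow> 'a) \<Rightarrow> ('a \<Rightarrow> 'a) \<Rightarrow> bool" where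
  "op_le E S T \<longleftrightarrow> (\<forall>x\<in>E. 0 \<le> cinner (T x - S x) x)"

definition op_prod :: "('a \<Rightarrow> 'a) list \<Rightarrow> 'a \<Rightarrow> 'a" where
  "op_prod Ts = foldr (\<circ>) Ts id"

section \<open>Multiplication operators and inner functions\<close>

definition H2 :: "'a::chilbert_space set \<Rightarrow> 'a hardy set" where
  "H2 E = {f. \<forall>z\<in>unit_disc. hardy_eval f z \<in> E}"

definition op_holomorphic ::
    "'a::complex_inner set \<Rightarrow> 'b::complex_inner set \<Rightarrow> (complex \<Rightarrow> 'a \<Rightarrow> 'b) \<Rightarrow> bool" where
  "op_holomorphic E F \<Theta> \<longleftrightarrow> (\<forall>z\<in>unit_disc. \<exists>D\<in>bounded_ops E F.
     ((\<lambda>w. op_norm E (\<lambda>x. (1 / (w - z)) *\<^sub>C (\<Theta> w x - \<Theta> z x) - D x)) \<longlongrightarrow> 0) (at z))"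

definition Hinf ::
    "'a::complex_inner set \<Rightarrow> 'b::complex_inner set \<Rightarrow> (complex \<Rightarrow> 'a \<Rightarrow> 'b) set" where
  "Hinf E F = {\<Theta>. (\<forall>z\<in>unit_disc. \<Theta> z \<in> bounded_ops E F) \<and> op_holomorphic E F \<Theta> \<and>
     (\<exists>K. \<forall>z\<in>unit_disc. op_norm E (\<Theta> z) \<le> K)}"

text \<open>\<open>mult_op \<Theta>\<close> is the multiplication operator \<open>f \<mapsto> \<Theta> f\<close>.
  It is meaningful when the product lies in the Hardy space, as it does for \<open>\<Theta>\<close> in \<open>Hinf\<close>.\<close>

definition mult_op ::
    "(complex \<Rightarrow> 'a \<Rightarrow> 'b) \<Rightarrow> 'a::chilbert_space hardy \<Rightarrow> 'b::chilbert_space hardy" where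
  "mult_op \<Theta> f = Abs_hardy (\<lambda>z. if z \<in> unit_disc then \<Theta> z (hardy_eval f z) else 0)"

text \<open>\<open>\<Theta>\<close> is inner if multiplication by \<open>\<Theta>\<close> is an isometry from \<open>H2 E\<close> into \<open>H2 F\<close>. This is
  stated through the pointwise product, so that it does not depend on the value of
  \<^const>\<open>Abs_hardy\<close> outside its domain. If \<open>\<Theta>\<close> is inner then \<open>x \<mapsto> \<Theta> x\<close> embeds \<open>E\<close> isometrically
  in \<open>H2 F\<close>; thus, up to unitary equivalence, the Hilbert spaces \<open>E\<close> that admit an inner function
  into a given \<open>F\<close> in type \<open>'b\<close> are closed subspaces of \<open>'b hardy\<close>.\<close>

definition inner_function ::
    "'a::chilbert_space set \<Rightarrow> 'b::chilbert_space set \<Rightarrow> (complex \<Rightarrow> 'a \<Rightarrow> 'b) \<Rightarrow> bool" where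
  "inner_function E F \<Theta> \<longleftrightarrow> \<Theta> \<in> Hinf E F \<and>
     (\<forall>h\<in>H2 E. \<exists>g\<in>H2 F.
        (\<forall>z\<in>unit_disc. hardy_eval g z = \<Theta> z (hardy_eval h z)) \<and> norm g = norm h)"

section \<open>Model isometries\<close>

text \<open>The model tuple is given by its symbols \<open>\<Phi> 1, \<dots>, \<Phi> n\<close>. In the last condition the summand
  for \<open>k\<close> is \<open>U\<^sub>1\<^sup>* \<cdots> U\<^sub>k\<^sub>-\<^sub>1\<^sup>* P\<^sub>k U\<^sub>k\<^sub>-\<^sub>1 \<cdots> U\<^sub>1\<close>.\<close>

definition model_isometry ::
    "nat \<Rightarrow> 'a::chilbert_space set \<Rightarrow> (nat \<Rightarrow> complex \<Rightarrow> 'a \<Rightarrow> 'a) \<Rightarrow> bool" where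
  "model_isometry n E \<Phi> \<longleftrightarrow> (\<exists>U P.
     (\<forall>i\<in>{1..n}. unitary_on E (U i) \<and> orth_proj_on E (P i) \<and>
        (\<forall>z\<in>unit_disc. \<forall>x\<in>E. \<Phi> i z x = U i ((x - P i x) + z *\<^sub>C P i x))) \<and>
     (\<forall>i\<in>{1..n}. \<forall>j\<in>{1..n}. \<forall>x\<in>E. U i (U j x) = U j (U i x)) \<and>
     (\<forall>x\<in>E. op_prod (map U [1..<n+1]) x = x) \<and>
     (\<forall>i\<in>{1..n}. \<forall>j\<in>{1..n}. i \<noteq> j \<longrightarrow>
        (\<forall>x\<in>E. P i x + adj E (U i) (P j (U i x)) = P j x + adj E (U j) (P i (U j x))) \<and>
        op_le E (\<lambda>x. P i x + adj E (U i) (P j (U i x))) (\<lambda>x. x)) \<and>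
     (\<forall>x\<in>E. (\<Sum>k=1..n. op_prod (map (\<lambda>i. adj E (U i)) [1..<k])
                (P k (op_prod (map U (rev [1..<k])) x))) = x))"

end

theory Submission
  imports Defs
begin

text \<open>The symbols of a model \<open>n\<close>-isometry commute and their product is \<open>z\<close>, so a subspace \<open>S\<close>
  invariant under all of them is invariant under the shift. Its wandering subspace
  \<open>E = S \<ominus> zS\<close> carries the inner function \<open>\<Theta>(z) x = x(z)\<close> of Beurling, Lax and Halmos. The
  restrictions \<open>T\<^sub>i\<close> of the multiplication operators to \<open>S\<close> are commuting isometries whose product is
  the shift \<open>V\<close>; hence \<open>T\<^sub>i w = A\<^sub>i w + V B\<^sub>i w\<close> on \<open>E\<close> with \<open>A\<^sub>i w, B\<^sub>i w \<in> E\<close>, and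
  \<open>U\<^sub>i = A\<^sub>i + B\<^sub>i\<close> is unitary with \<open>B\<^sub>i = U\<^sub>i P\<^sub>i\<close> for a projection \<open>P\<^sub>i\<close>. For divisors \<open>R\<close>, \<open>R'\<close> of
  \<open>V\<close> whose product again divides \<open>V\<close> one has \<open>U\<^bsub>RR'\<^esub> = U\<^bsub>R\<^esub> U\<^bsub>R'\<^esub>\<close> and
  \<open>P\<^bsub>RR'\<^esub> = P\<^bsub>R'\<^esub> + U\<^bsub>R'\<^esub>\<^sup>* P\<^bsub>R\<^esub> U\<^bsub>R'\<^esub>\<close>, and all conditions on the model are instances of these two
  rules.\<close>

section \<open>Operators on closed subspaces\<close>

text \<open>Let \<open>R\<close> divide \<open>V\<close> with cofactor \<open>R'\<close>, and write
  \<open>N(T)\<close> for the orthogonal complement of the range of \<open>T\<close> in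
  \<open>S\<close>. Then \<open>E = N(R') \<oplus> R' N(R)\<close> and also
  \<open>E = R N(R') \<oplus> N(R)\<close>. The unitary of \<open>R\<close> matches the two
  splittings, \<open>x + R' y \<mapsto> R x + y\<close>, and its projection is the one onto
  \<open>R' N(R)\<close>. The cofactor is what keeps the symbol of degree one: an isometry that
  merely commutes with \<open>V\<close>, such as the square of \<open>V\<close>, has an expansion of
  higher degree.

  The two composition rules express that symbols multiply: the unitary is the symbol at
  \<open>z = 1\<close>, the coefficient of \<open>z\<close> obeys a product rule, and the
  coefficient of \<open>z\<^sup>2\<close> must vanish as soon as the product divides
  \<open>V\<close> again.

  That the given symbols multiply to \<open>z\<close> rests on their form
  \<open>U (I + (z - 1) P)\<close>. By (d) the projections, moved to a common place by conjugation,
  sum to the identity; hence they are mutually orthogonal and no higher power of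
  \<open>z - 1\<close> survives.

  Since \<open>E\<close> consists of functions, the new model space lives in the type
  \<open>'w hardy\<close>.\<close>

lemma scaleC_minus_right: "c *\<^sub>C (- x) = - (c *\<^sub>C (x :: 'a::complex_vector))"
  by (metis scaleC_add_right scaleC_zero_right add.right_inverse minus_unique)

lemma scaleC_diff_right: "c *\<^sub>C (x - y) = c *\<^sub>C x - c *\<^sub>C (y :: 'a::complex_vector)"
  by (metis scaleC_add_right scaleC_minus_right add_uminus_conv_diff)

lemma scaleC_diff_left: "(c - d) *\<^sub>C x = c *\<^sub>C x - d *\<^sub>C (x :: 'a::complex_vector)"
  by (metis scaleC_add_left diff_add_cancel add_diff_cancel)

lemma cinner_scaleR_left: "cinner (r *\<^sub>R x) y = of_real r * cinner x (y :: 'a::complex_inner)"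
  by (simp add: scaleR_scaleC cinner_scaleC_left)

lemma cinner_minus_left [simp]: "cinner (- x) y = - cinner x (y :: 'a::complex_inner)"
  using cinner_scaleR_left[of "-1" x y] by simp

lemma cinner_diff_left: "cinner (x - y) w = cinner x w - cinner y (w :: 'a::complex_inner)"
  using cinner_add_left[of x "- y" w] by simp

lemma cinner_zero_left [simp]: "cinner 0 (y :: 'a::complex_inner) = 0"
  using cinner_diff_left[of y y y] by simp

lemma cinner_minus_right [simp]: "cinner y (- x) = - cinner y (x :: 'a::complex_inner)"
  by (metis cinner_commute cinner_minus_left complex_cnj_minus)

lemma cinner_diff_right: "cinner w (x - y) = cinner w x - cinner w (y :: 'a::complex_inner)"
  using cinner_add_right[of w x "- y"] by simp

lemma cinner_eq_0_commute: "cinner x y = 0 \<longleftrightarrow> cinner y (x :: 'a::complex_inner) = 0"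
  by (metis cinner_commute complex_cnj_zero)

lemma cinner_self_eq_0 [simp]: "cinner x x = 0 \<longleftrightarrow> x = (0 :: 'a::complex_inner)"
  by (simp add: cinner_self)

lemma bounded_linear_cinner_left: "bounded_linear (\<lambda>x :: 'a::complex_inner. cinner x y)"
  by (rule bounded_linear_intro[where K = "norm y"])
    (simp_all add: cinner_add_left cinner_scaleR_left scaleR_conv_of_real cmod_cinner_le)

text \<open>As \<open>Re (\<i> * c) = - Im c\<close>, an identity of real parts valid at both
  \<open>x\<close> and \<open>\<i> *\<^sub>C x\<close> is a complex identity. This lifts facts about
  \<open>inner\<close> to \<open>cinner\<close>.\<close>

lemma complex_eqI_mult_i: "Re c = Re d \<Longrightarrow> Re (\<i> * c) = Re (\<i> * d) \<Longrightarrow> c = d"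
  by (simp add: complex_eq_iff)

locale csubspace =
  fixes E :: "'a::chilbert_space set"
  assumes closed_csubspace: "closed_csubspace E"
begin

lemma closed: "closed E"
  and zero_mem [simp]: "0 \<in> E"
  and add_mem [simp]: "x \<in> E \<Longrightarrow> y \<in> E \<Longrightarrow> x + y \<in> E"
  and scaleC_mem [simp]: "x \<in> E \<Longrightarrow> c *\<^sub>C x \<in> E"
  using closed_csubspace by (auto simp: closed_csubspace_def)

lemma scaleR_mem [simp]: "x \<in> E \<Longrightarrow> r *\<^sub>R x \<in> E"
  by (simp add: scaleR_scaleC)

lemma minus_mem [simp]: "x \<in> E \<Longrightarrow> - x \<in> E"
  using scaleR_mem[of x "-1"] by simp

lemma diff_mem [simp]: "x \<in> E \<Longrightarrow> y \<in> E \<Longrightarrow> x - y \<in> E"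
  using add_mem[of x "- y"] by simp

lemma sum_mem: "(\<And>i. i \<in> I \<Longrightarrow> f i \<in> E) \<Longrightarrow> sum f I \<in> E"
  by (induction I rule: infinite_finite_induct) auto

lemma suminf_mem:
  assumes "\<And>n. f n \<in> E" "summable f"
  shows "suminf f \<in> E"
  using closed_sequentially[OF closed, of "\<lambda>n. sum f {..<n}"] summable_LIMSEQ[OF assms(2)] assms(1)
  by (auto intro: sum_mem)

lemma ops_mem: "T \<in> bounded_ops E F \<Longrightarrow> x \<in> E \<Longrightarrow> T x \<in> F"
  and ops_add: "T \<in> bounded_ops E F \<Longrightarrow> x \<in> E \<Longrightarrow> y \<in> E \<Longrightarrow> T (x + y) = T x + T y"
  and ops_scaleC: "T \<in> bounded_ops E F \<Longrightarrow> x \<in> E \<Longrightarrow> T (c *\<^sub>C x) = c *\<^sub>C T x"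
  by (auto simp: bounded_ops_def)

lemma ops_diff: "T \<in> bounded_ops E F \<Longrightarrow> x \<in> E \<Longrightarrow> y \<in> E \<Longrightarrow> T (x - y) = T x - T y"
  using ops_add[of T F "x - y" y] by (simp add: eq_diff_eq)

lemma ops_zero: "T \<in> bounded_ops E F \<Longrightarrow> T 0 = 0"
  using ops_scaleC[of T F 0 0] by simp

lemma ops_bound:
  assumes "T \<in> bounded_ops E F"
  obtains K where "K \<ge> 0" "\<And>x. x \<in> E \<Longrightarrow> norm (T x) \<le> K * norm x"
proof -
  obtain K where K: "\<And>x. x \<in> E \<Longrightarrow> norm (T x) \<le> K * norm x"
    using assms unfolding bounded_ops_def by blast
  have "norm (T x) \<le> \<bar>K\<bar> * norm x" if "x \<in> E" for x
    using K[OF that] mult_right_mono[OF abs_ge_self[of K] norm_ge_zero[of x]] by linarith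
  thus thesis using that[of "\<bar>K\<bar>"] by simp
qed

text \<open>The representing vector is the minimum of \<open>\<lambda>x. \<parallel>x\<parallel>\<^sup>2 - 2 f x\<close>, whose minimizing sequences are
  Cauchy by the parallelogram law.\<close>

lemma riesz:
  fixes f :: "'a \<Rightarrow> real"
  assumes add: "\<And>x y. x \<in> E \<Longrightarrow> y \<in> E \<Longrightarrow> f (x + y) = f x + f y"
    and scale: "\<And>r x. x \<in> E \<Longrightarrow> f (r *\<^sub>R x) = r * f x"
    and bound: "\<And>x. x \<in> E \<Longrightarrow> \<bar>f x\<bar> \<le> K * norm x"
  shows "\<exists>w\<in>E. \<forall>x\<in>E. f x = inner x w"
proof -
  define q where "q x = (norm x)\<^sup>2 - 2 * f x" for x
  have q_ge: "q x \<ge> - K\<^sup>2" if "x \<in> E" for x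
    using bound[OF that] zero_le_power2[of "norm x - K"]
    unfolding q_def by (simp add: power2_eq_square algebra_simps)
  define m where "m = Inf (q ` E)"
  have bdd: "bdd_below (q ` E)" using q_ge by (intro bdd_belowI2) auto
  have m_le: "m \<le> q x" if "x \<in> E" for x unfolding m_def using that bdd by (rule cINF_lower[rotated])
  have "\<exists>x\<in>E. q x < m + 1 / real (Suc k)" for k
  proof -
    have *: "Inf (q ` E) < m + 1 / real (Suc k)" by (simp add: m_def)
    have "q ` E \<noteq> {}" using zero_mem by blast
    from cInf_lessD[OF this *] show ?thesis by auto
  qed
  then obtain X where X: "\<And>k. X k \<in> E" "\<And>k. q (X k) < m + 1 / real (Suc k)" by metis
  have par: "(norm (x - y))\<^sup>2 \<le> 2 * (q x - m) + 2 * (q y - m)" if "x \<in> E" "y \<in> E" for x y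
  proof -
    define h where "h = (1/2) *\<^sub>R (x + y)"
    have "m \<le> q h" using that by (intro m_le) (simp add: h_def)
    moreover have "f h = (f x + f y) / 2" unfolding h_def by (simp add: add scale that)
    moreover have "(norm h)\<^sup>2 = (norm (x + y))\<^sup>2 / 4"
      by (simp add: h_def power_mult_distrib power_divide)
    moreover have "(norm (x + y))\<^sup>2 + (norm (x - y))\<^sup>2 = 2 * (norm x)\<^sup>2 + 2 * (norm y)\<^sup>2"
      by (simp add: power2_norm_eq_inner inner_simps inner_commute)
    ultimately show ?thesis by (simp add: q_def) (simp add: field_simps)
  qed
  have "Cauchy X"
  proof (rule metric_CauchyI)
    fix e :: real assume "e > 0"
    obtain N where "4 / e\<^sup>2 < real N" using reals_Archimedean2 by blast
    hence N: "4 / e\<^sup>2 < real (Suc N)" by simp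
    have "dist (X i) (X j) < e" if "i \<ge> N" "j \<ge> N" for i j
    proof -
      define r where "r = 1 / real (Suc N)"
      have *: "q (X k) < m + r" if "k \<ge> N" for k
      proof -
        have "1 / real (Suc k) \<le> r" using that by (simp add: r_def frac_le)
        from less_le_trans[OF X(2) add_left_mono[OF this]] show ?thesis .
      qed
      have arith: "s < 4 * r" if "s \<le> 2 * (a - m) + 2 * (b - m)" "a < m + r" "b < m + r" for s a b
        using that by argo
      have "(norm (X i - X j))\<^sup>2 < 4 * r"
        by (rule arith[OF par[OF X(1) X(1)] *[OF that(1)] *[OF that(2)]])
      also have "\<dots> < e\<^sup>2" using N \<open>e > 0\<close> by (simp add: r_def field_simps)
      finally show ?thesis using \<open>e > 0\<close> by (simp add: dist_norm power2_less_imp_less)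
    qed
    thus "\<exists>M. \<forall>i\<ge>M. \<forall>j\<ge>M. dist (X i) (X j) < e" by blast
  qed
  then obtain w where w: "X \<longlonglongrightarrow> w" using Cauchy_convergent convergent_def by blast
  have wE: "w \<in> E" using closed_sequentially[OF closed] X(1) w by blast
  have "(\<lambda>k. f (X k)) \<longlonglongrightarrow> f w"
  proof (rule LIM_zero_cancel, rule Lim_null_comparison)
    have "(\<lambda>k. K * norm (X k - w)) \<longlonglongrightarrow> K * norm (w - w)"
      by (intro tendsto_intros w)
    thus "(\<lambda>k. K * norm (X k - w)) \<longlonglongrightarrow> 0" by simp
    have "f (X k) - f w = f (X k - w)" for k
      using add[of "X k - w" w] X(1) wE by simp
    thus "\<forall>\<^sub>F k in sequentially. norm (f (X k) - f w) \<le> K * norm (X k - w)"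
      using bound X(1) wE by simp
  qed
  hence "(\<lambda>k. q (X k)) \<longlonglongrightarrow> q w" unfolding q_def by (intro tendsto_intros w)
  moreover have "(\<lambda>k. m + 1 / real (Suc k)) \<longlonglongrightarrow> m + 0"
    using LIMSEQ_inverse_real_of_nat by (intro tendsto_add) (auto simp: inverse_eq_divide)
  ultimately have "q w \<le> m + 0"
    by (rule LIMSEQ_le) (use X(2) less_imp_le in blast)
  hence qw: "q w \<le> m" by simp
  have "f x = inner x w" if x: "x \<in> E" for x
  proof (rule ccontr)
    define d where "d = inner x w - f x"
    assume "f x \<noteq> inner x w"
    hence d: "d \<noteq> 0" by (simp add: d_def)
    hence x0: "(norm x)\<^sup>2 > 0" using scale[OF x, of 0] unfolding d_def by auto
    \<comment> \<open>The minimiser of \<open>2 * t * d + t\<^sup>2 * (norm x)\<^sup>2\<close>, the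
      change of \<open>q\<close> when moving from \<open>w\<close> in direction
      \<open>x\<close>.\<close>
    define t where "t = - d / (norm x)\<^sup>2"
    have "q w \<le> q (w + t *\<^sub>R x)" using m_le[of "w + t *\<^sub>R x"] qw x wE by auto
    also have "q (w + t *\<^sub>R x) = q w + 2 * t * d + t\<^sup>2 * (norm x)\<^sup>2"
    proof -
      have "(norm (w + t *\<^sub>R x))\<^sup>2 = (norm w)\<^sup>2 + 2 * t * inner x w + t\<^sup>2 * (norm x)\<^sup>2"
        unfolding power2_norm_eq_inner
        by (simp add: inner_simps inner_commute[of w x] power2_eq_square algebra_simps)
      thus ?thesis unfolding q_def d_def using x wE by (simp add: add scale algebra_simps)
    qed
    also have "2 * t * d + t\<^sup>2 * (norm x)\<^sup>2 = - d\<^sup>2 / (norm x)\<^sup>2"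
      using x0 by (simp add: t_def power2_eq_square field_simps)
    hence "q w + 2 * t * d + t\<^sup>2 * (norm x)\<^sup>2 = q w - d\<^sup>2 / (norm x)\<^sup>2" by simp
    finally show False using d x0 by (simp add: divide_le_0_iff)
  qed
  thus ?thesis using wE by blast
qed

text \<open>Discharges the \<open>THE\<close> in \<open>adj\<close>: two candidates differ by a
  vector of \<open>E\<close> that is orthogonal to \<open>E\<close>.\<close>

lemma adj_eqI:
  assumes "w \<in> E" "\<And>x. x \<in> E \<Longrightarrow> cinner (T x) y = cinner x w"
  shows "adj E T y = w"
  unfolding adj_def
proof (rule the_equality)
  fix v assume v: "v \<in> E \<and> (\<forall>x\<in>E. cinner (T x) y = cinner x v)"
  hence "cinner (v - w) (v - w) = 0"
    using assms by (metis cinner_diff_right diff_mem cancel_comm_monoid_add_class.diff_cancel)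
  thus "v = w" by simp
qed (use assms in auto)

lemma adj_cong: "(\<And>x. x \<in> E \<Longrightarrow> S x = T x) \<Longrightarrow> adj E S y = adj E T y"
  unfolding adj_def by (intro arg_cong[where f = The] ext) auto

text \<open>Existence comes from \<open>riesz\<close> applied to the real functional
  \<open>Re (cinner (T x) y)\<close>. The vector \<open>y\<close> may be any ambient vector.\<close>

lemma adj:
  assumes T: "T \<in> bounded_ops E F"
  shows adj_mem: "adj E T y \<in> E"
    and cinner_adj: "x \<in> E \<Longrightarrow> cinner x (adj E T y) = cinner (T x) y"
proof -
  obtain K where K: "\<And>x. x \<in> E \<Longrightarrow> norm (T x) \<le> K * norm x" using ops_bound[OF T] by metis
  have "\<exists>w\<in>E. \<forall>x\<in>E. Re (cinner (T x) y) = inner x w"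
  proof (rule riesz)
    fix x assume x: "x \<in> E"
    have "\<bar>Re (cinner (T x) y)\<bar> \<le> cmod (cinner (T x) y)" by (rule abs_Re_le_cmod)
    also have "\<dots> \<le> norm (T x) * norm y" by (rule cmod_cinner_le)
    also have "\<dots> \<le> K * norm x * norm y" using K[OF x] by (intro mult_right_mono) auto
    finally show "\<bar>Re (cinner (T x) y)\<bar> \<le> K * norm y * norm x" by (simp add: mult_ac)
  qed (use T in \<open>auto simp: ops_add ops_scaleC scaleR_scaleC cinner_add_left cinner_scaleC_left\<close>)
  then obtain w where w: "w \<in> E" "\<And>x. x \<in> E \<Longrightarrow> Re (cinner (T x) y) = Re (cinner x w)"
    by (auto simp: inner_eq_Re_cinner)
  have *: "cinner (T x) y = cinner x w" if "x \<in> E" for x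
    using w(2)[OF that] w(2)[of "\<i> *\<^sub>C x"] that T
    by (intro complex_eqI_mult_i) (simp_all add: ops_scaleC cinner_scaleC_left)
  show "adj E T y \<in> E" using adj_eqI[OF w(1) *] w(1) by simp
  show "x \<in> E \<Longrightarrow> cinner x (adj E T y) = cinner (T x) y" using adj_eqI[OF w(1) *] * by simp
qed

lemma adj_add: "T \<in> bounded_ops E F \<Longrightarrow> adj E T (x + y) = adj E T x + adj E T y"
  by (rule adj_eqI) (simp_all add: adj_mem cinner_add_right cinner_adj)

lemma adj_scaleC: "T \<in> bounded_ops E F \<Longrightarrow> adj E T (c *\<^sub>C x) = c *\<^sub>C adj E T x"
  by (rule adj_eqI) (simp_all add: adj_mem cinner_scaleC_right cinner_adj)

lemma adj_diff: "T \<in> bounded_ops E F \<Longrightarrow> adj E T (x - y) = adj E T x - adj E T y"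
  by (rule adj_eqI) (simp_all add: adj_mem cinner_diff_right cinner_adj)

lemma id_bounded_op: "(\<lambda>x. x) \<in> bounded_ops E E"
  by (auto simp: bounded_ops_def intro: exI[of _ 1])

text \<open>For ambient \<open>y\<close> the adjoint of the inclusion of \<open>E\<close> is the
  orthogonal projection of \<open>y\<close> onto \<open>E\<close>.\<close>

definition proj :: "'a \<Rightarrow> 'a" where
  "proj = adj E (\<lambda>x. x)"

lemma proj_mem [simp]: "proj x \<in> E"
  unfolding proj_def by (rule adj_mem[OF id_bounded_op])

lemma proj_eq [simp]: "x \<in> E \<Longrightarrow> proj x = x"
  unfolding proj_def by (rule adj_eqI) auto

lemma norm_proj_le: "norm (proj x) \<le> norm x"
proof -
  have "cinner (proj x) (proj x) = cinner (proj x) x"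
    unfolding proj_def using cinner_adj[OF id_bounded_op adj_mem[OF id_bounded_op]] by simp
  hence "(norm (proj x))\<^sup>2 = cmod (cinner (proj x) x)"
    by (metis cinner_self norm_of_real abs_power2)
  also have "\<dots> \<le> norm (proj x) * norm x" by (rule cmod_cinner_le)
  finally show ?thesis
    by (cases "norm (proj x) = 0") (auto simp: power2_eq_square)
qed

text \<open>Members of \<open>bounded_ops\<close> are linear on \<open>E\<close> only. Precomposing
  with \<open>proj\<close> makes them bounded linear on the whole type, so that they can be passed
  through infinite sums.\<close>

lemma bounded_linear_ops_proj:
  fixes T :: "'a \<Rightarrow> 'b::complex_inner"
  assumes T: "T \<in> bounded_ops E F"
  shows "bounded_linear (\<lambda>x. T (proj x))"
proof -
  obtain K where K: "K \<ge> 0" "\<And>x. x \<in> E \<Longrightarrow> norm (T x) \<le> K * norm x" using ops_bound[OF T] by metis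
  show ?thesis
  proof (rule bounded_linear_intro)
    fix x y :: 'a and r :: real
    show "T (proj (x + y)) = T (proj x) + T (proj y)"
      using ops_add[OF T proj_mem proj_mem] by (simp add: proj_def adj_add[OF id_bounded_op])
    show "T (proj (r *\<^sub>R x)) = r *\<^sub>R T (proj x)"
      using ops_scaleC[OF T proj_mem, of "of_real r" x]
      by (simp add: proj_def scaleR_scaleC adj_scaleC[OF id_bounded_op])
    show "norm (T (proj x)) \<le> norm x * K"
      using K(2)[OF proj_mem, of x] mult_left_mono[OF norm_proj_le K(1), of x] by (simp add: mult.commute)
  qed
qed

section \<open>Isometries, unitaries and orthogonal projections on a closed subspace\<close>

definition isom :: "('a \<Rightarrow> 'a) \<Rightarrow> bool" where
  "isom T \<longleftrightarrow> (\<forall>x\<in>E. T x \<in> E) \<and> (\<forall>x\<in>E. \<forall>y\<in>E. T (x + y) = T x + T y) \<and>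
     (\<forall>c. \<forall>x\<in>E. T (c *\<^sub>C x) = c *\<^sub>C T x) \<and> (\<forall>x\<in>E. norm (T x) = norm x)"

lemma isom_bounded_op: "isom T \<Longrightarrow> T \<in> bounded_ops E E"
  unfolding isom_def bounded_ops_def by (auto intro!: exI[of _ 1])

lemma isom_mem: "isom T \<Longrightarrow> x \<in> E \<Longrightarrow> T x \<in> E"
  and isom_add: "isom T \<Longrightarrow> x \<in> E \<Longrightarrow> y \<in> E \<Longrightarrow> T (x + y) = T x + T y"
  and isom_scaleC: "isom T \<Longrightarrow> x \<in> E \<Longrightarrow> T (c *\<^sub>C x) = c *\<^sub>C T x"
  and isom_norm: "isom T \<Longrightarrow> x \<in> E \<Longrightarrow> norm (T x) = norm x"
  by (auto simp: isom_def)

lemma isom_diff: "isom T \<Longrightarrow> x \<in> E \<Longrightarrow> y \<in> E \<Longrightarrow> T (x - y) = T x - T y"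
  by (rule ops_diff[OF isom_bounded_op])

lemma isom_zero: "isom T \<Longrightarrow> T 0 = 0"
  by (rule ops_zero[OF isom_bounded_op])

lemma isom_inj: "isom T \<Longrightarrow> x \<in> E \<Longrightarrow> y \<in> E \<Longrightarrow> T x = T y \<Longrightarrow> x = y"
  using isom_norm[of T "x - y"] by (simp add: isom_diff)

text \<open>Polarization gives the real part; replacing \<open>x\<close> by
  \<open>\<i> *\<^sub>C x\<close> gives the rest.\<close>

lemma isom_cinner:
  assumes "isom T" "x \<in> E" "y \<in> E"
  shows "cinner (T x) (T y) = cinner x y"
proof -
  have re: "Re (cinner (T u) (T v)) = Re (cinner u v)" if "u \<in> E" "v \<in> E" for u v
  proof -
    have "(norm (T u + T v))\<^sup>2 = (norm (u + v))\<^sup>2"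
      using assms(1) that by (metis isom_add isom_norm add_mem)
    moreover have "(norm (T u))\<^sup>2 = (norm u)\<^sup>2" "(norm (T v))\<^sup>2 = (norm v)\<^sup>2"
      using assms(1) that by (simp_all add: isom_norm)
    ultimately have "inner (T u) (T v) = inner u v"
      by (simp add: power2_norm_eq_inner inner_simps inner_commute)
    thus ?thesis by (simp add: inner_eq_Re_cinner)
  qed
  show ?thesis
    using re[OF assms(2,3)] re[OF scaleC_mem[OF assms(2), of \<i>] assms(3)] assms
    by (intro complex_eqI_mult_i) (simp_all add: isom_scaleC cinner_scaleC_left)
qed

lemma isom_comp: "isom S \<Longrightarrow> isom T \<Longrightarrow> isom (S \<circ> T)"
  unfolding isom_def by auto

lemma isom_id: "isom id"
  unfolding isom_def by auto

lemma adj_isom: "isom T \<Longrightarrow> x \<in> E \<Longrightarrow> adj E T (T x) = x"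
  by (rule adj_eqI) (simp_all add: isom_cinner)

lemma unitary_onI:
  assumes "isom U" "\<And>y. y \<in> E \<Longrightarrow> \<exists>x\<in>E. U x = y"
  shows "unitary_on E U"
  unfolding unitary_on_def using assms by (metis adj_isom isom_bounded_op)

lemma
  assumes "unitary_on E U"
  shows unitary_isom: "isom U"
    and unitary_adj_mem: "x \<in> E \<Longrightarrow> adj E U x \<in> E"
    and unitary_adj_left: "x \<in> E \<Longrightarrow> adj E U (U x) = x"
    and unitary_adj_right: "x \<in> E \<Longrightarrow> U (adj E U x) = x"
proof -
  have U: "U \<in> bounded_ops E E" using assms by (simp add: unitary_on_def)
  show "x \<in> E \<Longrightarrow> adj E U x \<in> E" by (rule adj_mem[OF U])
  show left: "x \<in> E \<Longrightarrow> adj E U (U x) = x" and "x \<in> E \<Longrightarrow> U (adj E U x) = x" for x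
    using assms by (auto simp: unitary_on_def)
  have "norm (U x) = norm x" if "x \<in> E" for x
  proof -
    have "cinner (U x) (U x) = cinner x x" using cinner_adj[OF U that, of "U x"] left[OF that] by simp
    thus ?thesis unfolding cinner_self of_real_eq_iff by (simp add: power2_eq_iff_nonneg)
  qed
  thus "isom U" using U by (simp add: isom_def bounded_ops_def)
qed

lemma
  assumes "orth_proj_on E P"
  shows orth_proj_bounded_op: "P \<in> bounded_ops E E"
    and orth_proj_idem: "x \<in> E \<Longrightarrow> P (P x) = P x"
    and orth_proj_cinner: "x \<in> E \<Longrightarrow> y \<in> E \<Longrightarrow> cinner (P x) y = cinner x (P y)"
proof -
  show P: "P \<in> bounded_ops E E" and "x \<in> E \<Longrightarrow> P (P x) = P x"
    using assms by (auto simp: orth_proj_on_def)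
  show "x \<in> E \<Longrightarrow> y \<in> E \<Longrightarrow> cinner (P x) y = cinner x (P y)"
    using cinner_adj[OF P, of x y] assms by (simp add: orth_proj_on_def)
qed

lemma orth_projI:
  assumes "P \<in> bounded_ops E E" "\<And>x. x \<in> E \<Longrightarrow> P (P x) = P x"
    "\<And>x y. x \<in> E \<Longrightarrow> y \<in> E \<Longrightarrow> cinner (P x) y = cinner x (P y)"
  shows "orth_proj_on E P"
  unfolding orth_proj_on_def using assms by (auto intro!: adj_eqI simp: ops_mem)

lemma orth_proj_cinner_self:
  "orth_proj_on E P \<Longrightarrow> x \<in> E \<Longrightarrow> cinner (P x) x = of_real ((norm (P x))\<^sup>2)"
  by (metis cinner_self orth_proj_bounded_op orth_proj_cinner orth_proj_idem ops_mem)

lemma orth_proj_perp: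
  "orth_proj_on E P \<Longrightarrow> x \<in> E \<Longrightarrow> y \<in> E \<Longrightarrow> cinner (P x) (y - P y) = 0"
  using ops_mem[OF orth_proj_bounded_op]
  by (simp add: cinner_diff_right orth_proj_cinner orth_proj_idem)

lemma orth_proj_op_le:
  assumes "orth_proj_on E P"
  shows "op_le E P (\<lambda>x. x)"
  unfolding op_le_def
proof
  fix x assume x: "x \<in> E"
  have "cinner (x - P x) x = cinner (x - P x) (x - P x) + cinner (x - P x) (P x)"
    by (simp flip: cinner_add_right)
  also have "cinner (x - P x) (P x) = 0"
    using orth_proj_perp[OF assms x x] cinner_eq_0_commute by blast
  finally show "0 \<le> cinner (x - P x) x" by (simp add: cinner_self less_eq_complex_def)
qed

end

section \<open>Products of commuting operators\<close>

lemma op_prod_Nil: "op_prod [] = id"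
  and op_prod_Cons: "op_prod (t # ts) = t \<circ> op_prod ts"
  by (simp_all add: op_prod_def)

lemma op_prod_append: "op_prod (ts @ us) = op_prod ts \<circ> op_prod us"
  by (induction ts) (simp_all add: op_prod_Nil op_prod_Cons comp_assoc)

lemma op_prod_snoc: "op_prod (ts @ [t]) = op_prod ts \<circ> t"
  by (simp add: op_prod_append op_prod_Nil op_prod_Cons)

context
  fixes E :: "'a set" and I :: "'i set" and T :: "'i \<Rightarrow> 'a \<Rightarrow> 'a"
  assumes mem: "i \<in> I \<Longrightarrow> x \<in> E \<Longrightarrow> T i x \<in> E"
begin

lemma op_prod_mem: "set l \<subseteq> I \<Longrightarrow> x \<in> E \<Longrightarrow> op_prod (map T l) x \<in> E"
  by (induction l) (auto simp: op_prod_Nil op_prod_Cons mem)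

context
  assumes commute: "i \<in> I \<Longrightarrow> j \<in> I \<Longrightarrow> x \<in> E \<Longrightarrow> T i (T j x) = T j (T i x)"
begin

lemma op_prod_commute:
  "set l \<subseteq> I \<Longrightarrow> i \<in> I \<Longrightarrow> x \<in> E \<Longrightarrow> op_prod (map T l) (T i x) = T i (op_prod (map T l) x)"
  by (induction l) (auto simp: op_prod_Nil op_prod_Cons commute op_prod_mem)

text \<open>Commuting factors may be reordered: the head of \<open>l\<close> is pulled to the front
  of \<open>m\<close>. Needed to reverse products over \<open>1, ..., n\<close> and to split off
  some of their factors.\<close>

lemma op_prod_mset:
  "mset l = mset m \<Longrightarrow> set l \<subseteq> I \<Longrightarrow> x \<in> E \<Longrightarrow> op_prod (map T l) x = op_prod (map T m) x"
proof (induction l arbitrary: m)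
  case (Cons i l)
  from Cons.prems(1) have "i \<in> set m" by (metis list.set_intros(1) mset_eq_setD)
  then obtain m1 m2 where m: "m = m1 @ i # m2" by (auto simp: in_set_conv_decomp)
  have sub: "set m \<subseteq> I" using Cons.prems by (metis mset_eq_setD)
  have "op_prod (map T m) x = op_prod (map T m1) (T i (op_prod (map T m2) x))"
    by (simp add: m op_prod_append op_prod_Cons)
  also have "\<dots> = T i (op_prod (map T m1) (op_prod (map T m2) x))"
    using sub m Cons.prems(3) by (intro op_prod_commute op_prod_mem) auto
  also have "\<dots> = T i (op_prod (map T (m1 @ m2)) x)" by (simp add: op_prod_append)
  also have "op_prod (map T (m1 @ m2)) x = op_prod (map T l) x"
    using Cons.prems by (intro Cons.IH[symmetric]) (auto simp: m)
  finally show ?case by (simp add: op_prod_Cons)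
qed simp

end

end

section \<open>Commuting isometries on the wandering subspace of their product\<close>

locale isometry = csubspace H for H :: "'a::chilbert_space set" +
  fixes V :: "'a \<Rightarrow> 'a"
  assumes isom_V: "isom V"
begin

definition wandering :: "'a set" where
  "wandering = {w \<in> H. \<forall>y\<in>H. cinner w (V y) = 0}"

abbreviation V_adj :: "'a \<Rightarrow> 'a" where
  "V_adj \<equiv> adj H V"

lemmas V_op = isom_bounded_op[OF isom_V]
lemmas V_mem [simp] = isom_mem[OF isom_V]
lemmas V_adj_mem [simp] = adj_mem[OF V_op]
lemmas V_adj_V [simp] = adj_isom[OF isom_V]

lemma V_adj_cinner_left: "x \<in> H \<Longrightarrow> cinner (V_adj y) x = cinner y (V x)"
  using cinner_adj[OF V_op, of x y] by (metis cinner_commute)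

lemma wandering_mem: "w \<in> wandering \<Longrightarrow> w \<in> H"
  and wandering_orth: "w \<in> wandering \<Longrightarrow> y \<in> H \<Longrightarrow> cinner w (V y) = 0"
  by (auto simp: wandering_def)

lemma V_adj_eq_0: "w \<in> wandering \<Longrightarrow> V_adj w = 0"
  using V_adj_cinner_left[of "V_adj w" w] wandering_orth[of w "V_adj w"] by simp

lemma wanderingI: "w \<in> H \<Longrightarrow> V_adj w = 0 \<Longrightarrow> w \<in> wandering"
  by (auto simp: wandering_def simp flip: V_adj_cinner_left)

sublocale wand: csubspace wandering
proof
  have "wandering = (\<Inter>y\<in>H. {w. cinner w (V y) = 0}) \<inter> H"
    by (auto simp: wandering_def)
  moreover have "closed {w. cinner w (V y) = 0}" for y
    by (intro closed_Collect_eq continuous_intros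
        linear_continuous_on[OF bounded_linear_cinner_left])
  ultimately have "closed wandering" using closed by (simp add: closed_INT closed_Int)
  thus "closed_csubspace wandering"
    by (auto simp: closed_csubspace_def wandering_def cinner_add_left cinner_scaleC_left)
qed

lemma residual_wandering: "y \<in> H \<Longrightarrow> y - V (V_adj y) \<in> wandering"
  by (rule wanderingI) (simp_all add: adj_diff[OF V_op])

text \<open>\<open>V_adj\<close> annihilates wandering vectors and inverts \<open>V\<close>, so
  applying it reads off the second component.\<close>

lemma wandering_decomp_unique:
  assumes "a + V b = a' + V b'" "a \<in> wandering" "a' \<in> wandering" "b \<in> H" "b' \<in> H"
  shows "a = a' \<and> b = b'"
proof -
  have "V_adj (a + V b) = V_adj (a' + V b')" using assms(1) by simp
  hence "b = b'"
    unfolding adj_add[OF V_op] using assms(2-) by (simp add: V_adj_eq_0)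
  thus ?thesis using assms(1) by simp
qed

text \<open>A divisor \<open>R\<close> of \<open>V\<close> acts on the wandering subspace by \<open>R w = corner R w + V (carry R w)\<close>,
  that is by the symbol \<open>z \<mapsto> corner R + z carry R\<close>. The unitary and the projection of the model
  are recovered from \<open>corner R = U P\<^sup>\<bottom>\<close> and \<open>carry R = U P\<close>.\<close>

definition divisor :: "('a \<Rightarrow> 'a) \<Rightarrow> bool" where
  "divisor R \<longleftrightarrow> isom R \<and> (\<exists>R'. isom R' \<and> (\<forall>x\<in>H. R (R' x) = V x \<and> R' (R x) = V x))"

definition carry :: "('a \<Rightarrow> 'a) \<Rightarrow> 'a \<Rightarrow> 'a" where
  "carry R w = V_adj (R w)"

definition corner :: "('a \<Rightarrow> 'a) \<Rightarrow> 'a \<Rightarrow> 'a" where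
  "corner R w = R w - V (carry R w)"

definition unit :: "('a \<Rightarrow> 'a) \<Rightarrow> 'a \<Rightarrow> 'a" where
  "unit R w = corner R w + carry R w"

text \<open>If \<open>R'\<close> is the cofactor of \<open>R\<close>, then \<open>carry R\<close> is
  the adjoint of \<open>R'\<close> on \<open>H\<close>, and \<open>prj R\<close> is
  \<open>R'\<close> followed by that adjoint in reverse order: the projection onto the range of
  \<open>R'\<close>.\<close>

definition prj :: "('a \<Rightarrow> 'a) \<Rightarrow> 'a \<Rightarrow> 'a" where
  "prj R w = adj H R (V (carry R w))"

lemma divisor_isom: "divisor R \<Longrightarrow> isom R"
  by (simp add: divisor_def)

lemma divisor_commute:
  assumes "divisor R" "x \<in> H"
  shows "R (V x) = V (R x)"
proof -
  obtain R' where "isom R'" and R': "\<And>x. x \<in> H \<Longrightarrow> R (R' x) = V x \<and> R' (R x) = V x"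
    using assms(1) by (auto simp: divisor_def)
  have "R (V x) = R (R' (R x))" using R' assms(2) by simp
  also have "\<dots> = V (R x)" using R'[of "R x"] isom_mem[OF divisor_isom] assms by simp
  finally show ?thesis .
qed

lemma divisor_decomp: "corner R w + V (carry R w) = R w"
  by (simp add: corner_def)

text \<open>Needed because products of the isometries in different orders agree only on
  \<open>H\<close>.\<close>

lemma unit_cong: "(\<And>x. x \<in> H \<Longrightarrow> R x = S x) \<Longrightarrow> w \<in> H \<Longrightarrow> unit R w = unit S w"
  by (simp add: unit_def corner_def carry_def)

lemma prj_cong: "(\<And>x. x \<in> H \<Longrightarrow> R x = S x) \<Longrightarrow> w \<in> H \<Longrightarrow> prj R w = prj S w"
  unfolding prj_def carry_def using adj_cong[of R S] by simp

context
  fixes R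
  assumes R: "divisor R"
begin

lemma corner_wandering [simp]: "w \<in> wandering \<Longrightarrow> corner R w \<in> wandering"
  unfolding corner_def carry_def
  by (rule residual_wandering) (simp add: isom_mem[OF divisor_isom[OF R]] wandering_mem)

text \<open>Here the cofactor enters: \<open>V (V y) = R (V (R' y))\<close>, so the isometry
  \<open>R\<close> cancels in the pairing with \<open>R w\<close> and leaves \<open>w\<close>
  against the range of \<open>V\<close>.\<close>

lemma carry_wandering [simp]: "w \<in> wandering \<Longrightarrow> carry R w \<in> wandering"
proof -
  assume w: "w \<in> wandering"
  obtain R' where R'i: "isom R'" and R': "\<And>x. x \<in> H \<Longrightarrow> R (R' x) = V x \<and> R' (R x) = V x"
    using R by (auto simp: divisor_def)
  note Ri = divisor_isom[OF R]
  have "cinner (V_adj (R w)) (V y) = 0" if y: "y \<in> H" for y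
  proof -
    have "cinner (V_adj (R w)) (V y) = cinner (R w) (V (V y))"
      using y by (simp add: V_adj_cinner_left)
    also have "V (V y) = R (V (R' y))"
      using R'[OF y] divisor_commute[OF R isom_mem[OF R'i y]] by simp
    also have "cinner (R w) \<dots> = cinner w (V (R' y))"
      using w y by (intro isom_cinner[OF Ri]) (simp_all add: wandering_mem isom_mem[OF R'i])
    finally show ?thesis using w y by (simp add: wandering_orth isom_mem[OF R'i])
  qed
  thus ?thesis by (simp add: carry_def wandering_def)
qed

lemma carry_mem [simp]: "carry R w \<in> H"
  by (simp add: carry_def)

lemma carry_add: "x \<in> H \<Longrightarrow> y \<in> H \<Longrightarrow> carry R (x + y) = carry R x + carry R y"
  by (simp add: carry_def isom_add[OF divisor_isom[OF R]] adj_add[OF V_op])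

lemma carry_scaleC: "x \<in> H \<Longrightarrow> carry R (c *\<^sub>C x) = c *\<^sub>C carry R x"
  by (simp add: carry_def isom_scaleC[OF divisor_isom[OF R]] adj_scaleC[OF V_op])

lemma corner_add: "x \<in> H \<Longrightarrow> y \<in> H \<Longrightarrow> corner R (x + y) = corner R x + corner R y"
  by (simp add: corner_def carry_add isom_add[OF divisor_isom[OF R]] isom_add[OF isom_V])

lemma corner_scaleC: "x \<in> H \<Longrightarrow> corner R (c *\<^sub>C x) = c *\<^sub>C corner R x"
  by (simp add: corner_def carry_scaleC isom_scaleC[OF divisor_isom[OF R]] isom_scaleC[OF isom_V]
      scaleC_diff_right)

lemma unit_wandering [simp]: "w \<in> wandering \<Longrightarrow> unit R w \<in> wandering"
  by (simp add: unit_def)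

lemma unit_add: "x \<in> H \<Longrightarrow> y \<in> H \<Longrightarrow> unit R (x + y) = unit R x + unit R y"
  by (simp add: unit_def carry_add corner_add)

lemma unit_scaleC: "x \<in> H \<Longrightarrow> unit R (c *\<^sub>C x) = c *\<^sub>C unit R x"
  by (simp add: unit_def carry_scaleC corner_scaleC scaleC_add_right)

text \<open>Because \<open>V = R R'\<close>, the vector \<open>V (carry R w)\<close> is the image
  under \<open>R\<close> of \<open>R' (carry R w)\<close>, which is what the adjoint in
  \<open>prj\<close> returns. On that vector the corner vanishes, so \<open>unit\<close> and
  \<open>carry\<close> coincide there.\<close>

lemma
  assumes w: "w \<in> wandering"
  shows prj_wandering [simp]: "prj R w \<in> wandering"
    and R_prj: "R (prj R w) = V (carry R w)"
    and carry_prj: "carry R (prj R w) = carry R w"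
    and unit_prj: "unit R (prj R w) = carry R w"
proof -
  obtain R' where R'i: "isom R'" and R': "\<And>x. x \<in> H \<Longrightarrow> R (R' x) = V x \<and> R' (R x) = V x"
    using R by (auto simp: divisor_def)
  note Ri = divisor_isom[OF R]
  have prj: "prj R w = R' (carry R w)"
    unfolding prj_def using R'[of "carry R w"] adj_isom[OF Ri isom_mem[OF R'i]] carry_mem by metis
  have mem: "prj R w \<in> H" by (simp add: prj isom_mem[OF R'i])
  show RP: "R (prj R w) = V (carry R w)" using R' by (simp add: prj)
  show cP: "carry R (prj R w) = carry R w" by (simp add: carry_def[of R "prj R w"] RP)
  have "cinner (prj R w) (V y) = 0" if y: "y \<in> H" for y
  proof -
    have "cinner (prj R w) (V y) = cinner (R (prj R w)) (R (V y))"
      using y mem by (simp add: isom_cinner[OF Ri])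
    also have "\<dots> = cinner (V (carry R w)) (V (R y))"
      using y by (simp add: RP divisor_commute[OF R])
    also have "\<dots> = cinner (V_adj (R w)) (R y)"
      using y by (simp add: isom_cinner[OF isom_V] isom_mem[OF Ri] carry_def)
    also have "\<dots> = cinner (R w) (R (V y))"
      using y by (simp add: V_adj_cinner_left isom_mem[OF Ri] divisor_commute[OF R])
    also have "\<dots> = 0"
      using y w by (simp add: isom_cinner[OF Ri] wandering_mem wandering_orth)
    finally show ?thesis .
  qed
  thus "prj R w \<in> wandering" using mem by (simp add: wandering_def)
  show "unit R (prj R w) = carry R w" by (simp add: unit_def corner_def RP cP)
qed

lemma corner_eq: "w \<in> wandering \<Longrightarrow> corner R w = R (w - prj R w)"
  by (simp add: corner_def R_prj isom_diff[OF divisor_isom[OF R]] wandering_mem)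

lemma unit_residual: "w \<in> wandering \<Longrightarrow> unit R (w - prj R w) = corner R w"
  using unit_add[of "w - prj R w" "prj R w"] by (simp add: wandering_mem unit_prj unit_def[of R w])

text \<open>Both \<open>corner + V carry\<close> and \<open>corner + carry\<close> are orthogonal
  sums with the same norms of summands. In the first the corner is wandering; in the second
  \<open>corner R w = R (w - prj R w)\<close>, and pairing it with \<open>V_adj (R w)\<close>
  cancels \<open>R\<close> and leaves \<open>w\<close> against the range of
  \<open>V\<close>.\<close>

lemma unit_isom: "wand.isom (unit R)"
proof -
  note Ri = divisor_isom[OF R]
  have "norm (unit R w) = norm w" if w: "w \<in> wandering" for w
  proof -
    have d: "w - prj R w \<in> H" using w by (simp add: wandering_mem)
    have "cinner (carry R w) (corner R w) = cinner (R w) (V (R (w - prj R w)))"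
      using w d by (simp add: corner_eq carry_def V_adj_cinner_left isom_mem[OF Ri])
    also have "\<dots> = cinner w (V (w - prj R w))"
      using w d by (simp add: isom_cinner[OF Ri] wandering_mem flip: divisor_commute[OF R])
    finally have "cinner (carry R w) (corner R w) = 0" using w d by (simp add: wandering_orth)
    hence orth: "inner (corner R w) (carry R w) = 0"
      by (simp add: inner_eq_Re_cinner cinner_eq_0_commute[of "carry R w"])
    have "inner (corner R w) (V (carry R w)) = 0"
      using w by (simp add: inner_eq_Re_cinner wandering_orth)
    hence "(norm (R w))\<^sup>2 = (norm (corner R w))\<^sup>2 + (norm (V (carry R w)))\<^sup>2"
      by (subst divisor_decomp[symmetric]) (simp add: power2_norm_eq_inner inner_simps inner_commute)
    also have "\<dots> = (norm (unit R w))\<^sup>2"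
      using orth by (simp add: unit_def power2_norm_eq_inner inner_simps inner_commute)
        (simp add: isom_norm[OF isom_V] flip: power2_norm_eq_inner)
    finally show ?thesis
      using w by (simp add: isom_norm[OF Ri] wandering_mem power2_eq_iff_nonneg)
  qed
  thus ?thesis by (simp add: wand.isom_def unit_add unit_scaleC wandering_mem)
qed

lemma prj_orth_proj: "orth_proj_on wandering (prj R)"
proof (rule wand.orth_projI)
  note Ri = divisor_isom[OF R]
  \<comment> \<open>\<open>prj R\<close> is the adjoint of \<open>carry R\<close> composed with
    \<open>carry R\<close>; the right-hand side is Hermitian in \<open>x\<close> and
    \<open>y\<close>, which yields self-adjointness.\<close>
  have key: "cinner (prj R x) y = cinner (carry R x) (carry R y)" if "x \<in> wandering" "y \<in> wandering" for x y
  proof -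
    have "cinner (prj R x) y = cinner (R (prj R x)) (R y)"
      using that by (simp add: isom_cinner[OF Ri] wandering_mem)
    also have "\<dots> = cinner (carry R x) (carry R y)"
      using that cinner_adj[OF V_op carry_mem, of x "R y"] by (simp add: R_prj carry_def)
    finally show ?thesis .
  qed
  show "cinner (prj R x) y = cinner x (prj R y)" if "x \<in> wandering" "y \<in> wandering" for x y
    using key[OF that] key[OF that(2,1)] by (metis cinner_commute)
  show "prj R (prj R x) = prj R x" if "x \<in> wandering" for x
    using that by (simp add: prj_def[of R "prj R x"] carry_prj) (simp add: prj_def)
  have "norm (prj R x) \<le> 1 * norm x" if "x \<in> wandering" for x
  proof -
    have "norm (prj R x) = norm (carry R x)"
      using that R_prj[OF that] isom_norm[OF Ri, of "prj R x"] isom_norm[OF isom_V, of "carry R x"]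
      by (simp add: wandering_mem)
    moreover have "(norm (carry R x))\<^sup>2 \<le> norm x * norm (carry R x)"
    proof -
      have "(norm (carry R x))\<^sup>2 = cmod (cinner (R x) (V (carry R x)))"
        using V_adj_cinner_left[of "carry R x" "R x"]
        by (metis carry_def carry_mem cinner_self norm_of_real abs_power2)
      also have "\<dots> \<le> norm (R x) * norm (V (carry R x))" by (rule cmod_cinner_le)
      finally show ?thesis using that
        by (simp add: isom_norm[OF Ri] isom_norm[OF isom_V] wandering_mem)
    qed
    ultimately show ?thesis
      by (cases "norm (carry R x) = 0") (auto simp: power2_eq_square)
  qed
  moreover have "prj R (x + y) = prj R x + prj R y" "prj R (c *\<^sub>C x) = c *\<^sub>C prj R x"
    if "x \<in> wandering" "y \<in> wandering" for x y c
    using that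
    by (simp_all add: prj_def carry_add carry_scaleC wandering_mem isom_add[OF isom_V]
        isom_scaleC[OF isom_V] adj_add[OF isom_bounded_op[OF Ri]] adj_scaleC[OF isom_bounded_op[OF Ri]])
  ultimately show "prj R \<in> bounded_ops wandering wandering"
    unfolding bounded_ops_def by (auto intro!: exI[of _ 1] wand.zero_mem)
qed

end

text \<open>Two expansions of \<open>R (S w)\<close> in powers of \<open>V\<close> with coefficients in the wandering subspace
  are compared: the one of the divisor \<open>R \<circ> S\<close> has degree one.\<close>

lemma divisor_comp:
  assumes R: "divisor R" and S: "divisor S" and RS: "divisor (R \<circ> S)" and w: "w \<in> wandering"
  shows corner_comp: "corner (R \<circ> S) w = corner R (corner S w)"
    and carry_comp: "carry (R \<circ> S) w = carry R (corner S w) + corner R (carry S w)"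
    and carry_carry: "carry R (carry S w) = 0"
proof -
  define a b where "a = corner S w" and "b = carry S w"
  have ab: "a \<in> wandering" "b \<in> wandering" "a \<in> H" "b \<in> H"
    using S w by (auto simp: a_def b_def intro: wandering_mem)
  have mem: "corner R a \<in> wandering" "carry R a \<in> wandering"
      "corner R b \<in> wandering" "carry R b \<in> wandering"
    "corner (R \<circ> S) w \<in> wandering" "carry (R \<circ> S) w \<in> wandering"
    using R RS ab w by simp_all
  note Hmem = mem[THEN wandering_mem]
  have "(R \<circ> S) w = R (a + V b)"
    by (simp add: a_def b_def divisor_decomp)
  also have "\<dots> = R a + V (R b)"
    using ab by (simp add: isom_add[OF divisor_isom[OF R]] divisor_commute[OF R])
  also have "\<dots> = (corner R a + V (carry R a)) + V (corner R b + V (carry R b))"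
    by (simp only: divisor_decomp)
  also have "\<dots> = corner R a + V ((carry R a + corner R b) + V (carry R b))"
    using Hmem by (simp add: isom_add[OF isom_V] add.assoc)
  finally have "corner (R \<circ> S) w + V (carry (R \<circ> S) w)
      = corner R a + V ((carry R a + corner R b) + V (carry R b))"
    by (simp only: divisor_decomp)
  hence *: "corner (R \<circ> S) w = corner R a"
      "carry (R \<circ> S) w = (carry R a + corner R b) + V (carry R b)"
    using wandering_decomp_unique[OF _ mem(5,1)] Hmem by auto
  \<comment> \<open>Second comparison: the carry of a divisor is itself wandering, so its own
    expansion ends in \<open>V 0\<close>. This forces the coefficient of \<open>z\<^sup>2\<close>,
    which is \<open>carry R (carry S w)\<close>, to vanish.\<close>
  from *(2) have "carry (R \<circ> S) w + V 0 = (carry R a + corner R b) + V (carry R b)"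
    by (simp add: isom_zero[OF isom_V])
  with mem have "carry (R \<circ> S) w = carry R a + corner R b \<and> 0 = carry R b"
    by (intro wandering_decomp_unique) (simp_all add: Hmem)
  with *(1) show "corner (R \<circ> S) w = corner R (corner S w)"
    "carry (R \<circ> S) w = carry R (corner S w) + corner R (carry S w)" "carry R (carry S w) = 0"
    by (auto simp: a_def b_def)
qed

text \<open>\<open>unit R\<close> is the symbol of \<open>R\<close> at \<open>z = 1\<close>, and
  symbols multiply.\<close>

lemma unit_comp:
  assumes "divisor R" "divisor S" "divisor (R \<circ> S)" "w \<in> wandering"
  shows "unit (R \<circ> S) w = unit R (unit S w)"
proof -
  have "unit R (unit S w) = unit R (corner S w) + unit R (carry S w)"
    using assms by (simp add: unit_def[of S] unit_add wandering_mem)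
  thus ?thesis using divisor_comp[OF assms] by (simp add: unit_def)
qed

text \<open>\<open>carry_comp\<close> is the product rule for the coefficient of \<open>z\<close>.
  Replacing the corners in it by \<open>unit\<close> only adds terms
  \<open>carry R (carry S w)\<close>, which are zero. Keeping \<open>unit S\<close> in front avoids
  its adjoint.\<close>

lemma prj_comp:
  assumes R: "divisor R" and S: "divisor S" and RS: "divisor (R \<circ> S)" and w: "w \<in> wandering"
  shows "unit S (prj (R \<circ> S) w) = unit S (prj S w) + prj R (unit S w)"
proof (rule wand.isom_inj[OF unit_isom[OF R]])
  have "unit R (unit S (prj (R \<circ> S) w)) = carry R (corner S w) + corner R (carry S w)"
    using unit_comp[OF R S RS prj_wandering[OF RS w]] unit_prj[OF RS w] carry_comp[OF assms] by simp
  also have "\<dots> = unit R (carry S w) + carry R (unit S w)"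
    using carry_carry[OF assms] carry_add[OF R, of "corner S w" "carry S w"] S w
    by (simp add: unit_def wandering_mem)
  also have "\<dots> = unit R (unit S (prj S w) + prj R (unit S w))"
    using R S w by (simp add: unit_add wandering_mem unit_prj)
  finally show "unit R (unit S (prj (R \<circ> S) w)) = unit R (unit S (prj S w) + prj R (unit S w))" .
qed (use R S RS w in simp_all)

text \<open>The symbol of \<open>V\<close> is \<open>z\<close>, hence unitary and projection are
  both the identity. Applied to full products of the tuple, this gives the normalisations (b) and
  (d).\<close>

lemma
  assumes "w \<in> wandering" "\<And>x. x \<in> H \<Longrightarrow> R x = V x"
  shows unit_V: "unit R w = w" and prj_V: "prj R w = w"
proof -
  have "carry V w = w" "V \<in> bounded_ops H H"
    using assms(1) V_op by (simp_all add: carry_def wandering_mem)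
  hence "unit V w = w" "prj V w = w"
    using assms(1) by (simp_all add: unit_def corner_def prj_def wandering_mem)
  thus "unit R w = w" "prj R w = w"
    using unit_cong[OF assms(2)] prj_cong[OF assms(2)] assms(1) by (simp_all add: wandering_mem)
qed

lemma unit_id: "w \<in> wandering \<Longrightarrow> unit id w = w"
  by (simp add: unit_def corner_def carry_def V_adj_eq_0 isom_zero[OF isom_V])

lemma prj_id: "w \<in> wandering \<Longrightarrow> prj id w = 0"
  using adj_isom[OF isom_id zero_mem]
  by (simp add: prj_def carry_def V_adj_eq_0 isom_zero[OF isom_V])

text \<open>Only surjectivity is missing: \<open>R \<circ> R'\<close> acts as \<open>V\<close>, a
  divisor with cofactor \<open>id\<close>, so \<open>unit R'\<close> is a right inverse of
  \<open>unit R\<close>.\<close>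

lemma unit_unitary:
  assumes "divisor R"
  shows "unitary_on wandering (unit R)"
proof (rule wand.unitary_onI[OF unit_isom[OF assms]])
  fix y assume y: "y \<in> wandering"
  obtain R' where R': "isom R'" "\<And>x. x \<in> H \<Longrightarrow> R (R' x) = V x \<and> R' (R x) = V x"
    using assms by (auto simp: divisor_def)
  note Ri = divisor_isom[OF assms]
  have S: "divisor R'"
    unfolding divisor_def using R' Ri by blast
  have RS: "divisor (R \<circ> R')"
    unfolding divisor_def using R' isom_comp[OF Ri R'(1)] by (auto intro!: exI[of _ id] isom_id)
  show "\<exists>x\<in>wandering. unit R x = y"
    using unit_comp[OF assms S RS y] unit_V[OF y, of "R \<circ> R'"] R'(2) unit_wandering[OF S y]
    by (intro bexI[of _ "unit R' y"]) auto
qed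

end

section \<open>A commuting tuple with product \<open>V\<close>, and the conditions (a) to (d) on the
  wandering subspace\<close>

locale commuting_isometries = isometry H V for H :: "'a::chilbert_space set" and V +
  fixes n :: nat and T :: "nat \<Rightarrow> 'a \<Rightarrow> 'a"
  assumes isom_T: "i \<in> {1..n} \<Longrightarrow> isom (T i)"
    and T_commute: "i \<in> {1..n} \<Longrightarrow> j \<in> {1..n} \<Longrightarrow> x \<in> H \<Longrightarrow> T i (T j x) = T j (T i x)"
    and T_prod: "x \<in> H \<Longrightarrow> op_prod (map T [1..<n+1]) x = V x"
begin

abbreviation L :: "nat list \<Rightarrow> 'a \<Rightarrow> 'a" where
  "L l \<equiv> op_prod (map T l)"

lemma L_Nil: "L [] = id"
  and L_Cons: "L (i # l) = T i \<circ> L l"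
  and L_append: "L (l @ m) = L l \<circ> L m"
  by (simp_all add: op_prod_Nil op_prod_Cons op_prod_append)

lemma isom_L: "set l \<subseteq> {1..n} \<Longrightarrow> isom (L l)"
  by (induction l) (auto simp: L_Cons L_Nil isom_id intro!: isom_comp isom_T simp del: list.map)

lemma L_mset: "mset l = mset m \<Longrightarrow> set l \<subseteq> {1..n} \<Longrightarrow> x \<in> H \<Longrightarrow> L l x = L m x"
  by (rule op_prod_mset[where I = "{1..n}" and E = H]) (use isom_mem[OF isom_T] T_commute in blast)+

text \<open>The cofactor is the product over the complementary indices \<open>m\<close>;
  distinctness makes \<open>l @ m\<close> and \<open>m @ l\<close> permutations of
  \<open>1, ..., n\<close>.\<close>

lemma divisor_L:
  assumes "distinct l" "set l \<subseteq> {1..n}"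
  shows "divisor (L l)"
proof -
  define m where "m = filter (\<lambda>i. i \<notin> set l) [1..<n+1]"
  have "distinct (l @ m)" "distinct (m @ l)" "set (l @ m) = {1..n}" "set (m @ l) = {1..n}"
    using assms by (auto simp: m_def)
  moreover from this have "mset (l @ m) = mset [1..<n+1]" "mset (m @ l) = mset [1..<n+1]"
    by (subst set_eq_iff_mset_eq_distinct[symmetric]; auto)+
  ultimately have "L (l @ m) x = V x" "L (m @ l) x = V x" if "x \<in> H" for x
    using that L_mset[of "l @ m" "[1..<n+1]" x] L_mset[of "m @ l" "[1..<n+1]" x] T_prod[OF that]
    by (metis order_refl)+
  moreover have "isom (L m)" by (rule isom_L) (auto simp: m_def)
  ultimately show ?thesis
    unfolding divisor_def L_append using isom_L[OF assms(2)] by auto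
qed

lemma L_single: "L [i] = T i"
  by (simp add: op_prod_def)

lemma divisor_T: "i \<in> {1..n} \<Longrightarrow> divisor (T i)"
  using divisor_L[of "[i]"] unfolding L_single by simp

lemma unit_L:
  "distinct l \<Longrightarrow> set l \<subseteq> {1..n} \<Longrightarrow> w \<in> wandering \<Longrightarrow>
    unit (L l) w = op_prod (map (\<lambda>i. unit (T i)) l) w"
proof (induction l)
  case Nil thus ?case by (simp add: op_prod_def unit_id[unfolded id_def])
next
  case (Cons i l)
  have "divisor (T i \<circ> L l)" using divisor_L[of "i # l"] Cons.prems unfolding L_Cons by simp
  hence "unit (L (i # l)) w = unit (T i) (unit (L l) w)"
    unfolding L_Cons using Cons.prems by (intro unit_comp divisor_T divisor_L) auto
  also have "\<dots> = op_prod (map (\<lambda>i. unit (T i)) (i # l)) w"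
    using Cons by (simp add: op_prod_def)
  finally show ?case .
qed

text \<open>The list is reversed so that the last factor acts last, the order in which condition (d)
  applies the unitaries. The summand of index \<open>Suc k\<close> there involves
  \<open>prefix_prod k\<close>.\<close>

definition prefix_prod :: "nat \<Rightarrow> 'a \<Rightarrow> 'a" where
  "prefix_prod k = L (rev [1..<Suc k])"

lemma prefix_prod_0: "prefix_prod 0 = id"
  and prefix_prod_Suc: "prefix_prod (Suc k) = T (Suc k) \<circ> prefix_prod k"
  by (simp_all add: prefix_prod_def op_prod_def)

lemma divisor_prefix_prod: "k \<le> n \<Longrightarrow> divisor (prefix_prod k)"
  unfolding prefix_prod_def by (intro divisor_L) (auto simp del: upt_Suc)

lemma divisor_prefix_prod_Suc: "Suc k \<le> n \<Longrightarrow> divisor (T (Suc k) \<circ> prefix_prod k)"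
  using divisor_prefix_prod[of "Suc k"] by (simp add: prefix_prod_Suc)

lemma unit_prefix_prod:
  assumes "k \<le> n" "w \<in> wandering"
  shows "op_prod (map (\<lambda>i. unit (T i)) (rev [1..<Suc k])) w = unit (prefix_prod k) w"
  unfolding prefix_prod_def using assms by (intro unit_L[symmetric]) (auto simp del: upt_Suc)

lemma op_prod_adj:
  assumes "k \<le> n" "y \<in> wandering"
  shows "op_prod (map (\<lambda>i. adj wandering (unit (T i))) [1..<Suc k]) (unit (prefix_prod k) y) = y"
  using assms
proof (induction k arbitrary: y)
  case 0 thus ?case by (simp add: op_prod_def prefix_prod_0 unit_id[unfolded id_def])
next
  case (Suc k)
  have div: "divisor (T (Suc k))" "divisor (prefix_prod k)" "divisor (T (Suc k) \<circ> prefix_prod k)"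
    using Suc.prems by (auto intro: divisor_T divisor_prefix_prod divisor_prefix_prod_Suc)
  have "op_prod (map f [1..<Suc (Suc k)]) x = op_prod (map f [1..<Suc k]) (f (Suc k) x)"
    for f :: "nat \<Rightarrow> 'a \<Rightarrow> 'a" and x
    unfolding upt_Suc[of 1 "Suc k"] by (simp add: op_prod_snoc del: upt_Suc)
  moreover have "unit (prefix_prod k) y \<in> wandering" using div Suc.prems by simp
  ultimately show ?case
    using Suc.IH[of y] Suc.prems div unit_comp[OF div Suc.prems(2), folded prefix_prod_Suc]
    by (simp add: wand.unitary_adj_left[OF unit_unitary[OF div(1)]] del: upt_Suc)
qed

text \<open>The sum telescopes: by \<open>prj_comp\<close> the summand of index \<open>Suc k\<close>
  is \<open>prj (prefix_prod (Suc k)) w - prj (prefix_prod k) w\<close>, the adjoints undoing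
  \<open>unit (prefix_prod k)\<close>.\<close>

lemma sum_prj:
  assumes "k \<le> n" "w \<in> wandering"
  shows "(\<Sum>j=1..k. op_prod (map (\<lambda>i. adj wandering (unit (T i))) [1..<j])
      (prj (T j) (op_prod (map (\<lambda>i. unit (T i)) (rev [1..<j])) w))) = prj (prefix_prod k) w"
  using assms
proof (induction k)
  case 0 thus ?case by (simp add: prefix_prod_0 prj_id[unfolded id_def])
next
  case (Suc k)
  have div: "divisor (T (Suc k))" "divisor (prefix_prod k)" "divisor (T (Suc k) \<circ> prefix_prod k)"
    using Suc.prems by (auto intro: divisor_T divisor_prefix_prod divisor_prefix_prod_Suc)
  define d where "d = prj (T (Suc k) \<circ> prefix_prod k) w - prj (prefix_prod k) w"
  have d: "d \<in> wandering" unfolding d_def using div Suc.prems by simp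
  have "unit (prefix_prod k) d = prj (T (Suc k)) (unit (prefix_prod k) w)"
    unfolding d_def using prj_comp[OF div Suc.prems(2)] div Suc.prems
    by (simp add: wand.isom_diff[OF unit_isom])
  hence "op_prod (map (\<lambda>i. adj wandering (unit (T i))) [1..<Suc k])
      (prj (T (Suc k)) (op_prod (map (\<lambda>i. unit (T i)) (rev [1..<Suc k])) w)) = d"
    using op_prod_adj[of k d] unit_prefix_prod[of k w] d Suc.prems by (simp del: upt_Suc)
  moreover have "{1..Suc k} = insert (Suc k) {1..k}" by auto
  ultimately show ?case
    using Suc by (simp add: d_def del: upt_Suc flip: prefix_prod_Suc)
qed

lemma model_isometry_wandering:
  "model_isometry n wandering (\<lambda>i z w. unit (T i) ((w - prj (T i) w) + z *\<^sub>C prj (T i) w))"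
  unfolding model_isometry_def
proof (rule exI[of _ "\<lambda>i. unit (T i)"], rule exI[of _ "\<lambda>i. prj (T i)"], intro conjI ballI impI)
  note un = unit_unitary[OF divisor_T]
  have set_upt: "set (rev [1..<Suc n]) \<subseteq> {1..n}" "set [1..<Suc n] \<subseteq> {1..n}" by auto
  show "unitary_on wandering (unit (T i))" "orth_proj_on wandering (prj (T i))"
    if "i \<in> {1..n}" for i using un[OF that] prj_orth_proj[OF divisor_T[OF that]] by blast+
  have div2: "divisor (T i \<circ> T j)" if "i \<in> {1..n}" "j \<in> {1..n}" "i \<noteq> j" for i j
    using divisor_L[of "[i, j]"] that by (simp add: op_prod_def)
  show "unit (T i) (unit (T j) x) = unit (T j) (unit (T i) x)"
    if "i \<in> {1..n}" "j \<in> {1..n}" "x \<in> wandering" for i j x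
  \<comment> \<open>\<open>T i \<circ> T i\<close> need not divide \<open>V\<close>, so
    \<open>unit_comp\<close> is available only off the diagonal, where alone there is something to
    prove.\<close>
  proof (cases "i = j")
    case False
    have "unit (T i) (unit (T j) x) = unit (T i \<circ> T j) x"
      using that False by (intro unit_comp[symmetric] divisor_T div2)
    also have "\<dots> = unit (T j \<circ> T i) x"
      using that by (intro unit_cong) (auto simp: T_commute wandering_mem)
    also have "\<dots> = unit (T j) (unit (T i) x)"
      using that False by (intro unit_comp divisor_T div2) auto
    finally show ?thesis .
  qed simp
  show "op_prod (map (\<lambda>i. unit (T i)) [1..<n+1]) x = x" if "x \<in> wandering" for x
    using unit_L[of "[1..<n+1]" x] unit_V[of x "L [1..<n+1]"] set_upt(2) that T_prod by simp
  \<comment> \<open>Either side of (c) is the projection of the divisor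
    \<open>T j \<circ> T i\<close>: commutation gives the symmetry, and being a projection gives the
    bound by the identity.\<close>
  have pair: "prj (T i) x + adj wandering (unit (T i)) (prj (T j) (unit (T i) x)) = prj (T j \<circ> T i) x"
    if "i \<in> {1..n}" "j \<in> {1..n}" "i \<noteq> j" "x \<in> wandering" for i j x
  proof -
    note div = divisor_T[OF that(2)] divisor_T[OF that(1)] div2[OF that(2,1) that(3)[symmetric]]
    have "prj (T j) (unit (T i) x) = unit (T i) (prj (T j \<circ> T i) x - prj (T i) x)"
      using prj_comp[OF div that(4)] div that(4) by (simp add: wand.isom_diff[OF unit_isom])
    thus ?thesis using div that(4) by (simp add: wand.unitary_adj_left[OF un[OF that(1)]])
  qed
  show "prj (T i) x + adj wandering (unit (T i)) (prj (T j) (unit (T i) x)) =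
      prj (T j) x + adj wandering (unit (T j)) (prj (T i) (unit (T j) x))"
    if "i \<in> {1..n}" "j \<in> {1..n}" "i \<noteq> j" "x \<in> wandering" for i j x
  proof -
    have "prj (T j \<circ> T i) x = prj (T i \<circ> T j) x"
      using that by (intro prj_cong) (auto simp: T_commute wandering_mem)
    thus ?thesis using pair[OF that] pair[OF that(2,1) that(3)[symmetric] that(4)] by simp
  qed
  show "op_le wandering (\<lambda>x. prj (T i) x + adj wandering (unit (T i)) (prj (T j) (unit (T i) x))) (\<lambda>x. x)"
    if "i \<in> {1..n}" "j \<in> {1..n}" "i \<noteq> j" for i j
    using wand.orth_proj_op_le[OF prj_orth_proj[OF div2[OF that(2,1) that(3)[symmetric]]]] pair[OF that]
    by (simp add: op_le_def)
  show "(\<Sum>k=1..n. op_prod (map (\<lambda>i. adj wandering (unit (T i))) [1..<k])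
      (prj (T k) (op_prod (map (\<lambda>i. unit (T i)) (rev [1..<k])) x))) = x" if "x \<in> wandering" for x
  proof -
    have "prefix_prod n y = V y" if "y \<in> H" for y
      using L_mset[of "rev [1..<Suc n]" "[1..<Suc n]" y] set_upt(1) that T_prod
      by (simp add: prefix_prod_def del: upt_Suc)
    thus ?thesis using sum_prj[of n x] prj_V[of x "prefix_prod n"] that by simp
  qed
qed simp_all

lemma T_eq_symbol:
  assumes "i \<in> {1..n}" "w \<in> wandering"
  shows "T i w = unit (T i) (w - prj (T i) w) + V (unit (T i) (prj (T i) w))"
  using divisor_decomp[of "T i" w] assms by (simp add: unit_residual unit_prj divisor_T)

end

section \<open>Point evaluations and the shift\<close>

lemma hardy_eval_outside: "z \<notin> unit_disc \<Longrightarrow> hardy_eval f z = 0"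
  by (simp add: hardy_eval_coeff disc_series_def)

lemma hardy_eval_sums: "z \<in> unit_disc \<Longrightarrow> (\<lambda>n. z ^ n *\<^sub>C hardy_coeff f n) sums hardy_eval f z"
  using summable_disc_series[OF square_summable_hardy_coeff, of z f]
  by (simp add: hardy_eval_coeff disc_series_def unit_disc_iff summable_sums)

lemma hardy_eqI_eval:
  assumes "\<And>z. z \<in> unit_disc \<Longrightarrow> hardy_eval f z = hardy_eval g z"
  shows "f = g"
proof -
  have "hardy_eval f = hardy_eval g" using assms hardy_eval_outside by (metis ext)
  thus ?thesis by (simp add: hardy_eval_inject)
qed

text \<open>\<open>Abs_hardy\<close> is controlled only on its domain; exhibiting an element with
  the values of the product settles membership and value together.\<close>

lemma mult_op_eqI:
  assumes "\<And>z. z \<in> unit_disc \<Longrightarrow> hardy_eval g z = \<Theta> z (hardy_eval f z)"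
  shows "mult_op \<Theta> f = g"
proof -
  have "(\<lambda>z. if z \<in> unit_disc then \<Theta> z (hardy_eval f z) else 0) = hardy_eval g"
    using assms by (auto simp: hardy_eval_outside)
  thus ?thesis by (simp add: mult_op_def hardy_eval_inverse)
qed

lemma hardy_eval_add: "hardy_eval (f + g) z = hardy_eval f z + hardy_eval g z"
proof (cases "z \<in> unit_disc")
  case True
  from sums_add[OF hardy_eval_sums hardy_eval_sums, OF True True, of f g] hardy_eval_sums[OF True, of "f + g"]
  show ?thesis by (intro sums_unique2) (simp_all add: coeff_add scaleC_add_right)
qed (simp add: hardy_eval_outside)

lemma hardy_eval_scaleC: "hardy_eval (c *\<^sub>C f) z = c *\<^sub>C hardy_eval f z"
proof (cases "z \<in> unit_disc")
  case True
  from bounded_linear.sums[OF bounded_linear_scaleC hardy_eval_sums[OF True, of f], of c]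
    hardy_eval_sums[OF True, of "c *\<^sub>C f"]
  show ?thesis by (intro sums_unique2) (simp_all add: coeff_scaleC scaleC_scaleC mult.commute)
qed (simp add: hardy_eval_outside)

lemma hardy_norm_sums: "(\<lambda>n. (norm (hardy_coeff f n))\<^sup>2) sums (norm f)\<^sup>2"
  using summable_sums[OF summable_coeff[of f]]
  by (simp add: norm_hardy_def suminf_nonneg summable_coeff)

lemma hardy_cinner_sums:
  "(\<lambda>n. cinner (hardy_coeff f n) (hardy_coeff g n)) sums cinner f (g :: 'a::chilbert_space hardy)"
  using summable_sums[OF summable_cinner_coeff[of f g]] by (simp add: cinner_hardy_def)

lemma norm_coeff_le: "norm (hardy_coeff f n) \<le> norm f"
proof (rule power2_le_imp_le[OF _ norm_ge_zero])
  have "(\<Sum>k\<in>{n}. (norm (hardy_coeff f k))\<^sup>2) \<le> (norm f)\<^sup>2"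
    using hardy_norm_sums[of f] by (subst sums_unique[OF hardy_norm_sums])
      (intro sum_le_suminf, auto simp: sums_iff)
  thus "(norm (hardy_coeff f n))\<^sup>2 \<le> (norm f)\<^sup>2" by simp
qed

lemma bounded_linear_coeff: "bounded_linear (\<lambda>f :: 'a::chilbert_space hardy. hardy_coeff f n)"
  by (rule bounded_linear_intro[where K = 1]) (simp_all add: coeff_add coeff_scaleR norm_coeff_le)

lemma ex_hardy_coeff: "square_summable a \<Longrightarrow> \<exists>f. hardy_coeff f = a"
  using Abs_hardy_series(2) by blast

text \<open>The Szego kernel \<open>w \<mapsto> (1 / (1 - w * cnj z)) *\<^sub>C x\<close>, which
  reproduces evaluation at \<open>z\<close> in direction \<open>x\<close>.\<close>

definition kern :: "complex \<Rightarrow> 'a::chilbert_space \<Rightarrow> 'a hardy" where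
  "kern z x = Abs_hardy (disc_series (\<lambda>n. cnj z ^ n *\<^sub>C x))"

context
  fixes z assumes z: "z \<in> unit_disc"
begin

lemma sq_less_1: "(cmod z)\<^sup>2 < 1"
  using z by (simp add: unit_disc_iff abs_square_less_1)

lemma kern_norm_coeff_sums:
  "(\<lambda>n. (norm (cnj z ^ n *\<^sub>C (x :: 'a::chilbert_space)))\<^sup>2) sums ((norm x)\<^sup>2 / (1 - (cmod z)\<^sup>2))"
  using sums_mult2[OF geometric_sums[of "(cmod z)\<^sup>2"], of "(norm x)\<^sup>2"] sq_less_1
  by (simp add: norm_scaleC norm_power power_mult_distrib power_mult[symmetric] mult.commute)

lemma kern_coeff: "hardy_coeff (kern z x) n = cnj z ^ n *\<^sub>C (x :: 'a::chilbert_space)"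
  unfolding kern_def using kern_norm_coeff_sums[of x]
  by (subst Abs_hardy_series) (auto simp: square_summable_def sums_iff)

lemma norm_kern: "(norm (kern z x))\<^sup>2 = (norm (x :: 'a::chilbert_space))\<^sup>2 / (1 - (cmod z)\<^sup>2)"
  using hardy_norm_sums[of "kern z x"] kern_norm_coeff_sums[of x]
  by (intro sums_unique2) (simp_all add: kern_coeff)

lemma eval_kern: "hardy_eval (kern z x) z = (1 / (1 - (cmod z)\<^sup>2)) *\<^sub>R (x :: 'a::chilbert_space)"
proof -
  have "(\<lambda>n. ((cmod z)\<^sup>2) ^ n *\<^sub>R x) sums ((1 / (1 - (cmod z)\<^sup>2)) *\<^sub>R x)"
    using bounded_linear.sums[OF bounded_linear_scaleR_left geometric_sums[of "(cmod z)\<^sup>2"], of x]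
      sq_less_1 by simp
  moreover have "z ^ n *\<^sub>C cnj z ^ n *\<^sub>C x = ((cmod z)\<^sup>2) ^ n *\<^sub>R x" for n
    unfolding scaleC_scaleC scaleR_scaleC power_mult_distrib[symmetric] complex_norm_square[symmetric]
    by simp
  ultimately show ?thesis
    using hardy_eval_sums[OF z, of "kern z x"] by (simp add: kern_coeff sums_iff)
qed

lemma cinner_kern: "cinner f (kern z x) = cinner (hardy_eval f z) (x :: 'a::chilbert_space)"
proof -
  have "(\<lambda>n. cinner (z ^ n *\<^sub>C hardy_coeff f n) x) sums cinner (hardy_eval f z) x"
    by (rule bounded_linear.sums[OF bounded_linear_cinner_left hardy_eval_sums[OF z]])
  thus ?thesis using hardy_cinner_sums[of f "kern z x"]
    by (intro sums_unique2) (simp_all add: kern_coeff cinner_scaleC_left cinner_scaleC_right)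
qed

text \<open>Cauchy-Schwarz against the kernel in direction \<open>v = hardy_eval f z\<close>, after
  which the square of \<open>norm v\<close> cancels.\<close>

lemma norm_eval_le: "(1 - (cmod z)\<^sup>2) * (norm (hardy_eval f z))\<^sup>2 \<le> (norm f)\<^sup>2"
proof -
  define v where "v = hardy_eval f z"
  have "(norm v)\<^sup>2 = cmod (cinner f (kern z v))"
    by (simp add: cinner_kern v_def cinner_self norm_power)
  also have "\<dots> \<le> norm f * norm (kern z v)" by (rule cmod_cinner_le)
  finally have "((norm v)\<^sup>2)\<^sup>2 \<le> (norm f * norm (kern z v))\<^sup>2" by (intro power_mono) auto
  also have "\<dots> = (norm f)\<^sup>2 * ((norm v)\<^sup>2 / (1 - (cmod z)\<^sup>2))"
    by (simp add: power_mult_distrib norm_kern)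
  finally have "(1 - (cmod z)\<^sup>2) * (norm v)\<^sup>2 * (norm v)\<^sup>2 \<le> (norm f)\<^sup>2 * (norm v)\<^sup>2"
    using sq_less_1 by (simp add: field_simps power2_eq_square)
  thus ?thesis by (cases "v = 0") (auto simp: v_def)
qed

lemma bounded_linear_eval: "bounded_linear (\<lambda>f :: 'a::chilbert_space hardy. hardy_eval f z)"
proof (rule bounded_linear_intro[where K = "1 / sqrt (1 - (cmod z)\<^sup>2)"])
  fix f :: "'a hardy"
  have "(norm (hardy_eval f z))\<^sup>2 \<le> (norm f * (1 / sqrt (1 - (cmod z)\<^sup>2)))\<^sup>2"
    using norm_eval_le[of f] sq_less_1 by (simp add: power_mult_distrib power_divide field_simps)
  thus "norm (hardy_eval f z) \<le> norm f * (1 / sqrt (1 - (cmod z)\<^sup>2))"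
    by (rule power2_le_imp_le) (use sq_less_1 in simp)
qed (simp_all add: hardy_eval_add hardy_eval_scaleC scaleR_scaleC)

end

text \<open>\<open>H2\<close> is defined by values, while the arguments run on coefficients.
  Projecting the coefficients onto \<open>E\<close> does not change values that already lie in
  \<open>E\<close>, so by uniqueness it does not change the coefficients.\<close>

lemma (in csubspace) H2_iff: "f \<in> H2 E \<longleftrightarrow> (\<forall>n. hardy_coeff f n \<in> E)"
proof
  assume f: "f \<in> H2 E"
  define a where "a n = proj (hardy_coeff f n)" for n
  have proj: "bounded_linear proj" using bounded_linear_ops_proj[OF id_bounded_op] .
  have "square_summable a"
    unfolding square_summable_def a_def using summable_coeff[of f]
    by (rule summable_comparison_test') (simp add: power_mono norm_proj_le)
  then obtain g where g: "hardy_coeff g = a" using ex_hardy_coeff by blast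
  have "hardy_eval g z = hardy_eval f z" if z: "z \<in> unit_disc" for z
  proof -
    have "(\<lambda>n. proj (z ^ n *\<^sub>C hardy_coeff f n)) sums proj (hardy_eval f z)"
      by (rule bounded_linear.sums[OF proj hardy_eval_sums[OF z]])
    moreover have "proj (z ^ n *\<^sub>C hardy_coeff f n) = z ^ n *\<^sub>C hardy_coeff g n" for n
      by (simp add: g a_def proj_def adj_scaleC[OF id_bounded_op])
    moreover have "proj (hardy_eval f z) = hardy_eval f z" using f z by (simp add: H2_def)
    ultimately show ?thesis using hardy_eval_sums[OF z, of g] by (simp add: sums_iff)
  qed
  hence "g = f" by (rule hardy_eqI_eval)
  thus "\<forall>n. hardy_coeff f n \<in> E" using g proj_mem by (metis a_def)
next
  assume "\<forall>n. hardy_coeff f n \<in> E"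
  hence "hardy_eval f z \<in> E" if "z \<in> unit_disc" for z
    using suminf_mem[of "\<lambda>n. z ^ n *\<^sub>C hardy_coeff f n"] hardy_eval_sums[OF that, of f]
    by (simp add: sums_iff)
  thus "f \<in> H2 E" by (simp add: H2_def)
qed

lemma sums_shift:
  assumes "f sums s"
  shows "(\<lambda>n. case n of 0 \<Rightarrow> 0 | Suc m \<Rightarrow> f m) sums (s :: 'a::real_normed_vector)"
  by (rule sums_Suc_imp) (use assms in simp_all)

definition shift :: "'a::chilbert_space hardy \<Rightarrow> 'a hardy" where
  "shift f = Abs_hardy (disc_series (\<lambda>n. case n of 0 \<Rightarrow> 0 | Suc m \<Rightarrow> hardy_coeff f m))"

lemma coeff_shift: "hardy_coeff (shift f) n = (case n of 0 \<Rightarrow> 0 | Suc m \<Rightarrow> hardy_coeff f m)"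
proof -
  have "square_summable (\<lambda>n. case n of 0 \<Rightarrow> 0 | Suc m \<Rightarrow> hardy_coeff f m)"
    unfolding square_summable_def using summable_coeff[of f]
    by (subst summable_Suc_iff[symmetric]) simp
  thus ?thesis by (simp add: shift_def Abs_hardy_series)
qed

lemma norm_shift: "norm (shift f) = norm f"
proof -
  have "(norm (shift f))\<^sup>2 = (norm f)\<^sup>2"
    using hardy_norm_sums[of "shift f"] sums_shift[OF hardy_norm_sums[of f]]
    by (intro sums_unique2) (auto simp: coeff_shift split: nat.splits elim!: back_subst[where P = "\<lambda>f. f sums _"])
  thus ?thesis by (simp add: power2_eq_iff_nonneg)
qed

lemma eval_shift: "hardy_eval (shift f) z = z *\<^sub>C hardy_eval f z"
proof (cases "z \<in> unit_disc")
  case z: True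
  have "(\<lambda>n. z *\<^sub>C z ^ n *\<^sub>C hardy_coeff f n) sums (z *\<^sub>C hardy_eval f z)"
    by (rule bounded_linear.sums[OF bounded_linear_scaleC hardy_eval_sums[OF z]])
  from sums_shift[OF this] hardy_eval_sums[OF z, of "shift f"] show ?thesis
    by (intro sums_unique2) (auto simp: coeff_shift scaleC_scaleC split: nat.splits elim!: back_subst[where P = "\<lambda>f. f sums _"])
qed (simp add: hardy_eval_outside)

section \<open>Multiplication by the symbols of a model isometry\<close>

locale model_symbol = csubspace W for W :: "'w::chilbert_space set" +
  fixes U P :: "'w \<Rightarrow> 'w" and \<Phi> :: "complex \<Rightarrow> 'w \<Rightarrow> 'w"
  assumes unitary: "unitary_on W U" and orth_proj: "orth_proj_on W P"
    and symbol: "z \<in> unit_disc \<Longrightarrow> x \<in> W \<Longrightarrow> \<Phi> z x = U ((x - P x) + z *\<^sub>C P x)"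
begin

lemmas U_isom = unitary_isom[OF unitary]
lemmas P_op = orth_proj_bounded_op[OF orth_proj]
lemmas U_mem [simp] = isom_mem[OF U_isom]
lemmas P_mem [simp] = ops_mem[OF P_op]

lemma symbol_mem: "z \<in> unit_disc \<Longrightarrow> x \<in> W \<Longrightarrow> \<Phi> z x \<in> W"
  by (simp add: symbol)

text \<open>The form centred at \<open>z = 1\<close>, in which products of symbols collapse once the
  projections are orthogonal.\<close>

lemma symbol_pencil: "z \<in> unit_disc \<Longrightarrow> x \<in> W \<Longrightarrow> \<Phi> z x = U (x + (z - 1) *\<^sub>C P x)"
  by (simp add: symbol scaleC_diff_left algebra_simps)

lemma symbol_add: "z \<in> unit_disc \<Longrightarrow> x \<in> W \<Longrightarrow> y \<in> W \<Longrightarrow> \<Phi> z (x + y) = \<Phi> z x + \<Phi> z y"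
  by (simp add: symbol_pencil ops_add[OF P_op] scaleC_add_right flip: isom_add[OF U_isom])
    (simp add: algebra_simps)

lemma symbol_scaleC: "z \<in> unit_disc \<Longrightarrow> x \<in> W \<Longrightarrow> \<Phi> z (c *\<^sub>C x) = c *\<^sub>C \<Phi> z x"
  by (simp add: symbol_pencil ops_scaleC[OF P_op] scaleC_add_right scaleC_scaleC mult.commute
      flip: isom_scaleC[OF U_isom])

text \<open>The product has coefficients \<open>a n + b (n - 1)\<close>, with no \<open>b\<close>
  term at \<open>n = 0\<close>. The \<open>a\<close> part comes from the complement of
  \<open>P\<close> and the \<open>b\<close> part from \<open>P\<close>, so they are mutually
  orthogonal and the squared norms add up to that of \<open>f\<close>.\<close>

lemma
  assumes f: "f \<in> H2 W"
  shows mult_mem: "mult_op \<Phi> f \<in> H2 W"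
    and eval_mult: "z \<in> unit_disc \<Longrightarrow> hardy_eval (mult_op \<Phi> f) z = \<Phi> z (hardy_eval f z)"
    and norm_mult: "norm (mult_op \<Phi> f) = norm f"
proof -
  define a b where "a n = U (hardy_coeff f n - P (hardy_coeff f n))"
    and "b n = U (P (hardy_coeff f n))" for n
  define c where "c n = a n + (case n of 0 \<Rightarrow> 0 | Suc m \<Rightarrow> b m)" for n
  have fW: "hardy_coeff f n \<in> W" for n using f H2_iff by blast
  hence ab_mem: "a n \<in> W" "b n \<in> W" for n by (simp_all add: a_def b_def)
  have orth: "inner (a n) (b m) = 0" for n m
    using orth_proj_perp[OF orth_proj fW fW, of m n] fW
    by (simp add: a_def b_def isom_cinner[OF U_isom] inner_eq_Re_cinner
        cinner_eq_0_commute[of "P (hardy_coeff f m)"])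
  have orth_P: "inner (hardy_coeff f n - P (hardy_coeff f n)) (P (hardy_coeff f n)) = 0" for n
    using orth_proj_perp[OF orth_proj fW fW, of n n]
    by (simp add: inner_eq_Re_cinner cinner_eq_0_commute[of "P (hardy_coeff f n)"])
  have sum_ab: "(norm (a n))\<^sup>2 + (norm (b n))\<^sup>2 = (norm (hardy_coeff f n))\<^sup>2" for n
  proof -
    have "(norm (hardy_coeff f n))\<^sup>2
        = (norm ((hardy_coeff f n - P (hardy_coeff f n)) + P (hardy_coeff f n)))\<^sup>2" by simp
    also have "\<dots> = (norm (hardy_coeff f n - P (hardy_coeff f n)))\<^sup>2 + (norm (P (hardy_coeff f n)))\<^sup>2"
      using orth_P[of n] by (simp only: norm_add_Pythagorean orthogonal_def)
    finally show ?thesis using fW by (simp add: a_def b_def isom_norm[OF U_isom])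
  qed
  have "summable (\<lambda>n. (norm (a n))\<^sup>2)" "summable (\<lambda>n. (norm (b n))\<^sup>2)"
    by (rule summable_comparison_test'[OF summable_coeff[of f]],
        use sum_ab zero_le_power2 in \<open>simp add: le_iff_add flip: sum_ab\<close>)+
  then obtain \<alpha> \<beta> where \<alpha>: "(\<lambda>n. (norm (a n))\<^sup>2) sums \<alpha>" and \<beta>: "(\<lambda>n. (norm (b n))\<^sup>2) sums \<beta>"
    using summable_sums by blast
  have f_norm: "(norm f)\<^sup>2 = \<alpha> + \<beta>"
    using hardy_norm_sums[of f] sums_add[OF \<alpha> \<beta>] by (simp add: sum_ab sums_unique2)
  have "(norm (c n))\<^sup>2 = (norm (a n))\<^sup>2 + (case n of 0 \<Rightarrow> 0 | Suc m \<Rightarrow> (norm (b m))\<^sup>2)" for n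
    using orth by (cases n) (simp_all add: c_def norm_add_Pythagorean orthogonal_def)
  with sums_add[OF \<alpha> sums_shift[OF \<beta>]] have c_norm: "(\<lambda>n. (norm (c n))\<^sup>2) sums (\<alpha> + \<beta>)" by simp
  hence "square_summable c" by (auto simp: square_summable_def sums_iff)
  then obtain g where g: "hardy_coeff g = c" using ex_hardy_coeff by blast
  have eval: "hardy_eval g z = \<Phi> z (hardy_eval f z)" if z: "z \<in> unit_disc" for z
  proof -
    define v where "v = hardy_eval f z"
    have v: "v \<in> W" using f z by (simp add: H2_def v_def)
    have A_op: "(\<lambda>x. U (x - P x)) \<in> bounded_ops W W"
      unfolding bounded_ops_def
    proof (safe intro!: exI[of _ 2])
      fix x y c assume x: "x \<in> W" and y: "y \<in> W"
      show "U (x - P x) \<in> W" using x by simp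
      show "U (x + y - P (x + y)) = U (x - P x) + U (y - P y)"
        using x y by (simp add: ops_add[OF P_op] flip: isom_add[OF U_isom]) (simp add: algebra_simps)
      show "U (c *\<^sub>C x - P (c *\<^sub>C x)) = c *\<^sub>C U (x - P x)"
        using x by (simp add: ops_scaleC[OF P_op] scaleC_diff_right flip: isom_scaleC[OF U_isom])
      have "norm (P x) \<le> norm x"
      proof -
        have "(norm (P x))\<^sup>2 = cmod (cinner (P x) x)"
          by (simp add: orth_proj_cinner_self[OF orth_proj x] norm_power)
        also have "\<dots> \<le> norm (P x) * norm x" by (rule cmod_cinner_le)
        finally show ?thesis by (cases "norm (P x) = 0") (auto simp: power2_eq_square)
      qed
      thus "norm (U (x - P x)) \<le> 2 * norm x"
        using x norm_triangle_ineq4[of x "P x"] by (simp add: isom_norm[OF U_isom])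
    qed
    have B_op: "(\<lambda>x. U (P x)) \<in> bounded_ops W W"
    proof -
      obtain K where "\<And>x. x \<in> W \<Longrightarrow> norm (P x) \<le> K * norm x" using ops_bound[OF P_op] by metis
      thus ?thesis unfolding bounded_ops_def
        by (auto simp: ops_add[OF P_op] isom_add[OF U_isom] ops_scaleC[OF P_op]
            isom_scaleC[OF U_isom] isom_norm[OF U_isom])
    qed
    have s: "(\<lambda>n. T (z ^ n *\<^sub>C hardy_coeff f n)) sums T v" if "T \<in> bounded_ops W W" for T
      using bounded_linear.sums[OF bounded_linear_ops_proj[OF that] hardy_eval_sums[OF z, of f]]
        fW v by (simp add: v_def)
    have a: "(\<lambda>n. z ^ n *\<^sub>C a n) sums U (v - P v)"
      using s[OF A_op] fW by (simp add: ops_scaleC[OF A_op] a_def)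
    have "(\<lambda>n. z ^ n *\<^sub>C b n) sums U (P v)"
      using s[OF B_op] fW by (simp add: ops_scaleC[OF B_op] b_def)
    from sums_shift[OF bounded_linear.sums[OF bounded_linear_scaleC this, of z]]
    have b: "(\<lambda>n. z ^ n *\<^sub>C (case n of 0 \<Rightarrow> 0 | Suc m \<Rightarrow> b m)) sums (z *\<^sub>C U (P v))"
      by (rule back_subst[where P = "\<lambda>f. f sums _"]) (auto simp: scaleC_scaleC split: nat.splits)
    have "(\<lambda>n. z ^ n *\<^sub>C c n) sums (U (v - P v) + z *\<^sub>C U (P v))"
      using sums_add[OF a b] by (simp add: c_def scaleC_add_right)
    moreover have "U (v - P v) + z *\<^sub>C U (P v) = \<Phi> z v"
      using v z by (simp add: symbol isom_add[OF U_isom] isom_scaleC[OF U_isom])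
    ultimately show ?thesis using hardy_eval_sums[OF z, of g] by (simp add: g sums_iff v_def)
  qed
  have mult: "mult_op \<Phi> f = g" by (rule mult_op_eqI) (rule eval)
  show "z \<in> unit_disc \<Longrightarrow> hardy_eval (mult_op \<Phi> f) z = \<Phi> z (hardy_eval f z)" by (simp add: mult eval)
  have "c n \<in> W" for n using ab_mem by (simp add: c_def split: nat.splits)
  thus "mult_op \<Phi> f \<in> H2 W" by (simp add: mult H2_iff g)
  have "(norm g)\<^sup>2 = (norm f)\<^sup>2"
    using hardy_norm_sums[of g] c_norm by (simp add: g f_norm sums_unique2)
  thus "norm (mult_op \<Phi> f) = norm f" by (simp add: mult power2_eq_iff_nonneg)
qed

end

section \<open>Commutation and product of the symbols of a model isometry\<close>

locale model_tuple = csubspace W for W :: "'w::chilbert_space set" +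
  fixes n :: nat and U P :: "nat \<Rightarrow> 'w \<Rightarrow> 'w" and \<Phi> :: "nat \<Rightarrow> complex \<Rightarrow> 'w \<Rightarrow> 'w"
  assumes model_symbol: "i \<in> {1..n} \<Longrightarrow> model_symbol W (U i) (P i) (\<Phi> i)"
    and U_commute: "i \<in> {1..n} \<Longrightarrow> j \<in> {1..n} \<Longrightarrow> x \<in> W \<Longrightarrow> U i (U j x) = U j (U i x)"
    and U_prod: "x \<in> W \<Longrightarrow> op_prod (map U [1..<n+1]) x = x"
    and P_pair: "i \<in> {1..n} \<Longrightarrow> j \<in> {1..n} \<Longrightarrow> i \<noteq> j \<Longrightarrow> x \<in> W \<Longrightarrow>
        P i x + adj W (U i) (P j (U i x)) = P j x + adj W (U j) (P i (U j x))"
    and P_le: "i \<in> {1..n} \<Longrightarrow> j \<in> {1..n} \<Longrightarrow> i \<noteq> j \<Longrightarrow>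
        op_le W (\<lambda>x. P i x + adj W (U i) (P j (U i x))) (\<lambda>x. x)"
    and P_sum: "x \<in> W \<Longrightarrow> (\<Sum>k=1..n. op_prod (map (\<lambda>i. adj W (U i)) [1..<k])
        (P k (op_prod (map U (rev [1..<k])) x))) = x"

lemma model_isometry_iff:
  assumes "closed_csubspace W"
  shows "model_isometry n W \<Phi> \<longleftrightarrow> (\<exists>U P. model_tuple W n U P \<Phi>)"
proof -
  interpret csubspace W using assms by unfold_locales
  show ?thesis
    unfolding model_isometry_def model_tuple_def model_tuple_axioms_def model_symbol_def
      model_symbol_axioms_def using csubspace_axioms
    by (intro iff_exI) blast
qed

context model_tuple
begin

lemmas unitary = model_symbol.unitary[OF model_symbol]
lemmas orth_proj = model_symbol.orth_proj[OF model_symbol]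
lemmas U_isom = unitary_isom[OF unitary]
lemmas P_op = orth_proj_bounded_op[OF orth_proj]
lemmas U_mem [simp] = isom_mem[OF U_isom]
lemmas P_mem [simp] = ops_mem[OF P_op]
lemmas adj_U_mem [simp] = unitary_adj_mem[OF unitary]
lemmas symbol_mem [simp] = model_symbol.symbol_mem[OF model_symbol]
lemmas symbol_pencil = model_symbol.symbol_pencil[OF model_symbol]

text \<open>On the range of \<open>P i\<close> the bound in (c) leaves no room: with
  \<open>P i y = y\<close> the form of the second, positive term at \<open>y\<close> is at most
  zero, and it equals the square of \<open>norm (P j (U i y))\<close>.\<close>

lemma P_U_P_eq_0:
  assumes ij: "i \<in> {1..n}" "j \<in> {1..n}" "i \<noteq> j" and x: "x \<in> W"
  shows "P j (U i (P i x)) = 0"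
proof -
  define y where "y = P i x"
  have y: "y \<in> W" "P i y = y" using x ij orth_proj_idem[OF orth_proj[OF ij(1)] x] by (simp_all add: y_def)
  define q where "q = adj W (U i) (P j (U i y))"
  have "cinner q y = cinner (U i q) (U i y)"
    using y ij by (simp add: isom_cinner[OF U_isom] q_def)
  also have "\<dots> = of_real ((norm (P j (U i y)))\<^sup>2)"
    using y ij by (simp add: q_def unitary_adj_right[OF unitary] orth_proj_cinner_self[OF orth_proj])
  finally have "cinner q y = of_real ((norm (P j (U i y)))\<^sup>2)" .
  moreover have "0 \<le> cinner (y - (P i y + q)) y"
    using P_le[OF ij] y(1) by (auto simp: op_le_def q_def)
  ultimately have "(norm (P j (U i y)))\<^sup>2 \<le> 0"
    by (simp add: y(2) less_eq_complex_def)
  thus ?thesis by (simp add: y_def)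
qed

text \<open>The term in \<open>(z - 1)\<^sup>2\<close> drops out by \<open>P_U_P_eq_0\<close>. What
  remains is symmetric in \<open>i\<close> and \<open>j\<close> by (c) and commutation of the
  unitaries.\<close>

lemma symbol_symbol:
  assumes ij: "i \<in> {1..n}" "j \<in> {1..n}" "i \<noteq> j" and x: "x \<in> W" and z: "z \<in> unit_disc"
  shows "\<Phi> j z (\<Phi> i z x) = U j (U i (x + (z - 1) *\<^sub>C (P i x + adj W (U i) (P j (U i x)))))"
proof -
  define q where "q = adj W (U i) (P j (U i x))"
  have q: "q \<in> W" "U i q = P j (U i x)"
    using ij x by (simp_all add: q_def unitary_adj_right[OF unitary])
  define y where "y = x + (z - 1) *\<^sub>C P i x"
  have y: "y \<in> W" using ij x by (simp add: y_def)
  have "P j (U i y) = P j (U i x)"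
    unfolding y_def using ij x P_U_P_eq_0[OF ij x]
    by (simp add: isom_add[OF U_isom] isom_scaleC[OF U_isom] ops_add[OF P_op] ops_scaleC[OF P_op])
  hence "\<Phi> j z (\<Phi> i z x) = U j (U i y + (z - 1) *\<^sub>C U i q)"
    using ij x z y by (simp add: symbol_pencil q flip: y_def)
  also have "\<dots> = U j (U i (y + (z - 1) *\<^sub>C q))"
    using ij y q(1) by (simp add: isom_add[OF U_isom] isom_scaleC[OF U_isom])
  finally show ?thesis by (simp add: y_def q_def scaleC_add_right add.assoc)
qed

lemma symbol_commute:
  assumes "i \<in> {1..n}" "j \<in> {1..n}" "x \<in> W" "z \<in> unit_disc"
  shows "\<Phi> i z (\<Phi> j z x) = \<Phi> j z (\<Phi> i z x)"
proof (cases "i = j")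
  case False
  thus ?thesis
    using assms by (simp add: symbol_symbol P_pair[of i j x] U_commute[of i j])
qed simp

definition U_prefix :: "nat \<Rightarrow> 'w \<Rightarrow> 'w" where
  "U_prefix k = op_prod (map U (rev [1..<Suc k]))"

text \<open>The summand of index \<open>k\<close> in condition (d): \<open>P k\<close> conjugated by
  \<open>U_prefix (k - 1)\<close>, hence a projection. Later facts use \<open>Q (Suc k)\<close> so
  that the prefix has index \<open>k\<close>.\<close>

definition Q :: "nat \<Rightarrow> 'w \<Rightarrow> 'w" where
  "Q k x = op_prod (map (\<lambda>i. adj W (U i)) [1..<k]) (P k (op_prod (map U (rev [1..<k])) x))"

lemma U_prefix_0: "U_prefix 0 = id"
  and U_prefix_Suc: "U_prefix (Suc k) = U (Suc k) \<circ> U_prefix k"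
  by (simp_all add: U_prefix_def op_prod_Cons op_prod_Nil)

lemma U_prefix_isom: "k \<le> n \<Longrightarrow> isom (U_prefix k)"
  by (induction k) (auto simp: U_prefix_0 U_prefix_Suc isom_id intro!: isom_comp U_isom)

lemma U_prefix_adj:
  assumes "k \<le> n" "x \<in> W"
  shows "op_prod (map (\<lambda>i. adj W (U i)) [1..<Suc k]) x \<in> W \<and>
    U_prefix k (op_prod (map (\<lambda>i. adj W (U i)) [1..<Suc k]) x) = x"
  using assms
proof (induction k arbitrary: x)
  case (Suc k)
  hence "adj W (U (Suc k)) x \<in> W" "U (Suc k) (adj W (U (Suc k)) x) = x"
    using unitary_adj_mem[OF unitary, of "Suc k" x] unitary_adj_right[OF unitary, of "Suc k" x] by simp_all
  thus ?case
    using Suc unfolding upt_Suc[of 1 "Suc k"] by (simp add: op_prod_snoc U_prefix_Suc del: upt_Suc)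
qed (simp add: op_prod_Nil U_prefix_0)

lemma
  assumes "Suc k \<le> n" "x \<in> W"
  shows Q_mem: "Q (Suc k) x \<in> W"
    and U_prefix_Q: "U_prefix k (Q (Suc k) x) = P (Suc k) (U_prefix k x)"
  using assms U_prefix_adj[of k "P (Suc k) (U_prefix k x)"] isom_mem[OF U_prefix_isom, of k x]
    P_mem[of "Suc k" "U_prefix k x"]
  by (simp_all add: Q_def U_prefix_def del: upt_Suc)

lemma Q_cinner_self:
  assumes "Suc k \<le> n" "x \<in> W"
  shows "cinner (Q (Suc k) x) x = of_real ((norm (Q (Suc k) x))\<^sup>2)"
proof -
  note V = U_prefix_isom[OF Suc_leD[OF assms(1)]]
  have V_mem: "U_prefix k x \<in> W" by (rule isom_mem[OF V assms(2)])
  have "cinner (Q (Suc k) x) x = cinner (P (Suc k) (U_prefix k x)) (U_prefix k x)"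
    using isom_cinner[OF V Q_mem[OF assms] assms(2)] U_prefix_Q[OF assms] by simp
  also have "\<dots> = of_real ((norm (P (Suc k) (U_prefix k x)))\<^sup>2)"
    using assms(1) by (intro orth_proj_cinner_self[OF orth_proj] V_mem) simp
  also have "norm (P (Suc k) (U_prefix k x)) = norm (Q (Suc k) x)"
    using isom_norm[OF V Q_mem[OF assms]] U_prefix_Q[OF assms] by simp
  finally show ?thesis .
qed

lemma Q_idem:
  assumes "Suc k \<le> n" "x \<in> W"
  shows "Q (Suc k) (Q (Suc k) x) = Q (Suc k) x"
proof (rule isom_inj[OF U_prefix_isom])
  have "U_prefix k x \<in> W" using assms by (auto intro: isom_mem[OF U_prefix_isom])
  thus "U_prefix k (Q (Suc k) (Q (Suc k) x)) = U_prefix k (Q (Suc k) x)"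
    using assms by (simp add: U_prefix_Q Q_mem orth_proj_idem[OF orth_proj])
qed (use assms in \<open>auto intro: Q_mem\<close>)

text \<open>Projections whose sum is the identity are mutually orthogonal.\<close>

lemma Q_Q_eq_0:
  assumes "Suc k \<le> n" "Suc l \<le> n" "k \<noteq> l" "x \<in> W"
  shows "Q (Suc k) (Q (Suc l) x) = 0"
proof -
  define y where "y = Q (Suc l) x"
  have y: "y \<in> W" "Q (Suc l) y = y" using assms by (simp_all add: y_def Q_mem Q_idem)
  \<comment> \<open>Pairing this with \<open>y\<close> gives \<open>(norm y)\<^sup>2\<close> as a
    sum of squares whose term at \<open>l\<close> is already
    \<open>(norm y)\<^sup>2\<close>.\<close>
  have "y = (\<Sum>j<n. Q (Suc j) y)"
    using P_sum[OF y(1)] by (simp add: Q_def sum.atLeast1_atMost_eq del: upt_Suc)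
  hence "cinner y y = cinner (\<Sum>j<n. Q (Suc j) y) y" by simp
  also have "\<dots> = (\<Sum>j<n. cinner (Q (Suc j) y) y)"
    by (rule linear_sum[OF bounded_linear.linear[OF bounded_linear_cinner_left]])
  also have "\<dots> = of_real (\<Sum>j<n. (norm (Q (Suc j) y))\<^sup>2)"
    using y(1) by (simp add: Q_cinner_self)
  finally have "(norm y)\<^sup>2 = (\<Sum>j<n. (norm (Q (Suc j) y))\<^sup>2)"
    unfolding cinner_self of_real_eq_iff .
  also have "\<dots> = (norm y)\<^sup>2 + (\<Sum>j\<in>{..<n} - {l}. (norm (Q (Suc j) y))\<^sup>2)"
    using assms(2) y(2) by (subst sum.remove[of _ l]) auto
  finally have "(\<Sum>j\<in>{..<n} - {l}. (norm (Q (Suc j) y))\<^sup>2) = 0" by simp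
  hence "(norm (Q (Suc k) y))\<^sup>2 = 0"
    using assms by (subst (asm) sum_nonneg_eq_0_iff) auto
  thus ?thesis by (simp add: y_def)
qed

lemma Q_add: "Suc k \<le> n \<Longrightarrow> x \<in> W \<Longrightarrow> y \<in> W \<Longrightarrow> Q (Suc k) (x + y) = Q (Suc k) x + Q (Suc k) y"
  and Q_scaleC: "Suc k \<le> n \<Longrightarrow> x \<in> W \<Longrightarrow> Q (Suc k) (c *\<^sub>C x) = c *\<^sub>C Q (Suc k) x"
proof -
  assume k: "Suc k \<le> n" and x: "x \<in> W"
  note V = U_prefix_isom[OF Suc_leD[OF k]]
  have Pk: "P (Suc k) \<in> bounded_ops W W" using k by (intro P_op) auto
  show "Q (Suc k) (c *\<^sub>C x) = c *\<^sub>C Q (Suc k) x"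
    by (rule isom_inj[OF V])
      (use k x in \<open>simp_all add: U_prefix_Q Q_mem isom_scaleC[OF V] ops_scaleC[OF Pk] isom_mem[OF V]\<close>)
  assume y: "y \<in> W"
  show "Q (Suc k) (x + y) = Q (Suc k) x + Q (Suc k) y"
    by (rule isom_inj[OF V])
      (use k x y in \<open>simp_all add: U_prefix_Q Q_mem isom_add[OF V] ops_add[OF Pk] isom_mem[OF V]\<close>)
qed

lemma Q_sum:
  "Suc k \<le> n \<Longrightarrow> (\<And>i. i \<in> I \<Longrightarrow> f i \<in> W) \<Longrightarrow> Q (Suc k) (\<Sum>i\<in>I. f i) = (\<Sum>i\<in>I. Q (Suc k) (f i))"
  using Q_scaleC[of k 0 0]
  by (induction I rule: infinite_finite_induct) (simp_all add: Q_add sum_mem)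

text \<open>A further factor contributes only a first-order term: \<open>Q (Suc k)\<close>
  annihilates the earlier \<open>Q (Suc j) x\<close>, so it sees \<open>x\<close> alone.\<close>

lemma symbol_prefix:
  assumes "k \<le> n" "x \<in> W" "z \<in> unit_disc"
  shows "op_prod (map (\<lambda>i. \<Phi> i z) (rev [1..<Suc k])) x
    = U_prefix k (x + (z - 1) *\<^sub>C (\<Sum>j<k. Q (Suc j) x))"
  using assms(1)
proof (induction k)
  case 0 thus ?case by (simp add: op_prod_Nil U_prefix_0)
next
  case (Suc k)
  define y where "y = x + (z - 1) *\<^sub>C (\<Sum>j<k. Q (Suc j) x)"
  have QW: "Q (Suc j) x \<in> W" if "j < Suc k" for j using that Suc.prems assms(2) by (intro Q_mem) auto
  have sW: "(\<Sum>j<k. Q (Suc j) x) \<in> W" using QW by (intro sum_mem) auto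
  hence y: "y \<in> W" unfolding y_def using assms(2) by simp
  note V = U_prefix_isom[OF Suc_leD[OF Suc.prems]]
  have "Q (Suc k) (\<Sum>j<k. Q (Suc j) x) = (\<Sum>j<k. Q (Suc k) (Q (Suc j) x))"
    using Suc.prems QW by (intro Q_sum) auto
  also have "\<dots> = 0" using Suc.prems assms(2) by (intro sum.neutral) (auto intro: Q_Q_eq_0)
  finally have Qy: "Q (Suc k) y = Q (Suc k) x"
    unfolding y_def using Suc.prems assms(2) sW by (simp add: Q_add Q_scaleC)
  have "op_prod (map (\<lambda>i. \<Phi> i z) (rev [1..<Suc (Suc k)])) x = \<Phi> (Suc k) z (U_prefix k y)"
    using Suc unfolding upt_Suc[of 1 "Suc k"] by (simp add: op_prod_Cons y_def del: upt_Suc)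
  also have "\<dots> = U (Suc k) (U_prefix k y + (z - 1) *\<^sub>C U_prefix k (Q (Suc k) x))"
    using Suc.prems y assms(3) by (simp add: symbol_pencil isom_mem[OF V] U_prefix_Q flip: Qy)
  also have "\<dots> = U (Suc k) (U_prefix k (y + (z - 1) *\<^sub>C Q (Suc k) x))"
    using y QW[of k] by (simp add: isom_add[OF V] isom_scaleC[OF V])
  finally show ?case by (simp add: U_prefix_Suc y_def scaleC_add_right add.assoc)
qed

text \<open>At \<open>k = n\<close> condition (d) turns the pencil into \<open>z\<close> and (b)
  removes the unitary. Passing to the reversed order and back uses commutation of the symbols and of
  the unitaries.\<close>

lemma symbol_prod:
  assumes x: "x \<in> W" and z: "z \<in> unit_disc"
  shows "op_prod (map (\<lambda>i. \<Phi> i z) [1..<n+1]) x = z *\<^sub>C x"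
proof -
  have "op_prod (map (\<lambda>i. \<Phi> i z) [1..<n+1]) x = op_prod (map (\<lambda>i. \<Phi> i z) (rev [1..<n+1])) x"
    by (rule op_prod_mset[where I = "{1..n}" and E = W])
      (use x z in \<open>auto intro: symbol_commute simp del: upt_Suc One_nat_def\<close>)
  also have "\<dots> = U_prefix n (x + (z - 1) *\<^sub>C (\<Sum>j<n. Q (Suc j) x))"
    using symbol_prefix[OF order_refl x z] by simp
  also have "(\<Sum>j<n. Q (Suc j) x) = x"
    using P_sum[OF x] by (simp add: Q_def sum.atLeast1_atMost_eq del: upt_Suc)
  also have "x + (z - 1) *\<^sub>C x = z *\<^sub>C x" by (simp add: scaleC_diff_left)
  also have "U_prefix n (z *\<^sub>C x) = op_prod (map U [1..<n+1]) (z *\<^sub>C x)"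
    unfolding U_prefix_def
    by (rule op_prod_mset[where I = "{1..n}" and E = W])
      (use x in \<open>auto intro: U_commute simp del: upt_Suc One_nat_def\<close>)
  finally show ?thesis using U_prod x by simp
qed

lemma
  assumes "i \<in> {1..n}" "f \<in> H2 W"
  shows mult_mem: "mult_op (\<Phi> i) f \<in> H2 W"
    and eval_mult: "z \<in> unit_disc \<Longrightarrow> hardy_eval (mult_op (\<Phi> i) f) z = \<Phi> i z (hardy_eval f z)"
    and norm_mult: "norm (mult_op (\<Phi> i) f) = norm f"
  using assms model_symbol.mult_mem[OF model_symbol] model_symbol.eval_mult[OF model_symbol]
    model_symbol.norm_mult[OF model_symbol] by blast+

lemma eval_mult_prod:
  assumes "set l \<subseteq> {1..n}" "f \<in> H2 W" "z \<in> unit_disc"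
  shows "hardy_eval (op_prod (map (\<lambda>i. mult_op (\<Phi> i)) l) f) z
    = op_prod (map (\<lambda>i. \<Phi> i z) l) (hardy_eval f z)"
  using assms(1)
proof (induction l)
  case (Cons i l)
  have "op_prod (map (\<lambda>i. mult_op (\<Phi> i)) l) f \<in> H2 W"
    by (rule op_prod_mem[where I = "{1..n}"]) (use Cons.prems assms mult_mem in auto)
  thus ?case using Cons assms(3) by (simp add: op_prod_Cons eval_mult)
qed (simp add: op_prod_Nil)

lemma mult_prod:
  assumes "f \<in> H2 W"
  shows "op_prod (map (\<lambda>i. mult_op (\<Phi> i)) [1..<n+1]) f = shift f"
proof (rule hardy_eqI_eval)
  fix z assume z: "z \<in> unit_disc"
  have "set [1..<n+1] \<subseteq> {1..n}" by auto
  moreover have "hardy_eval f z \<in> W" using assms z by (simp add: H2_def)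
  ultimately show "hardy_eval (op_prod (map (\<lambda>i. mult_op (\<Phi> i)) [1..<n+1]) f) z = hardy_eval (shift f) z"
    using eval_mult_prod[OF _ assms z] symbol_prod[OF _ z] by (simp add: eval_shift)
qed

lemma mult_commute:
  assumes "i \<in> {1..n}" "j \<in> {1..n}" "f \<in> H2 W"
  shows "mult_op (\<Phi> i) (mult_op (\<Phi> j) f) = mult_op (\<Phi> j) (mult_op (\<Phi> i) f)"
proof (rule hardy_eqI_eval)
  fix z assume z: "z \<in> unit_disc"
  moreover have "hardy_eval f z \<in> W" using assms(3) z by (simp add: H2_def)
  ultimately show "hardy_eval (mult_op (\<Phi> i) (mult_op (\<Phi> j) f)) z
      = hardy_eval (mult_op (\<Phi> j) (mult_op (\<Phi> i) f)) z"
    using assms by (simp add: eval_mult mult_mem symbol_commute)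
qed

lemma mult_isom:
  assumes i: "i \<in> {1..n}" and S: "csubspace S" "S \<subseteq> H2 W" and inv: "mult_op (\<Phi> i) ` S \<subseteq> S"
  shows "csubspace.isom S (mult_op (\<Phi> i))"
  unfolding csubspace.isom_def[OF S(1)]
proof (intro conjI ballI allI)
  fix f g c assume f: "f \<in> S" and g: "g \<in> S"
  have H2: "f \<in> H2 W" "g \<in> H2 W" using f g S(2) by auto
  hence W: "hardy_eval f z \<in> W" "hardy_eval g z \<in> W" if "z \<in> unit_disc" for z
    using that by (auto simp: H2_def)
  show "mult_op (\<Phi> i) f \<in> S" using f inv by blast
  show "norm (mult_op (\<Phi> i) f) = norm f" by (rule norm_mult[OF i H2(1)])
  show "mult_op (\<Phi> i) (f + g) = mult_op (\<Phi> i) f + mult_op (\<Phi> i) g"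
    using W i H2 by (intro mult_op_eqI)
      (simp add: hardy_eval_add eval_mult model_symbol.symbol_add[OF model_symbol])
  show "mult_op (\<Phi> i) (c *\<^sub>C f) = c *\<^sub>C mult_op (\<Phi> i) f"
    using W i H2 by (intro mult_op_eqI)
      (simp add: hardy_eval_scaleC eval_mult model_symbol.symbol_scaleC[OF model_symbol])
qed

end

section \<open>Power series as operator-valued holomorphic functions\<close>

text \<open>The geometric series differentiated termwise once and twice. Truncated subtraction in
  the exponents is harmless, since the factor in front is zero there.\<close>

lemma summable_termdiff2:
  fixes K :: real
  assumes "\<bar>K\<bar> < 1"
  shows "summable (\<lambda>n. of_nat n * K ^ (n - Suc 0))"
    and "summable (\<lambda>n. of_nat n * of_nat (n - Suc 0) * K ^ (n - 2))"
proof -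
  have 0: "summable (\<lambda>n. 1 * x ^ n)" if "norm x < 1" for x :: real
    using that by simp
  have 1: "summable (\<lambda>n. diffs (\<lambda>_. 1) n * x ^ n)" if "norm x < 1" for x :: real
    by (rule termdiff_converges[OF that 0])
  have 2: "summable (\<lambda>n. diffs (diffs (\<lambda>_. 1)) n * x ^ n)" if "norm x < 1" for x :: real
    by (rule termdiff_converges[OF that 1])
  show "summable (\<lambda>n. of_nat n * K ^ (n - Suc 0))"
    using 1[of K] assms by (subst summable_Suc_iff[symmetric]) (simp add: diffs_def)
  show "summable (\<lambda>n. of_nat n * of_nat (n - Suc 0) * K ^ (n - 2))"
    using 2[of K] assms
    by (subst summable_iff_shift[symmetric, where k = 2]) (simp add: diffs_def mult_ac)
qed

lemma norm_suminf_scaleC_le: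
  fixes a :: "nat \<Rightarrow> 'a::chilbert_space"
  assumes "\<And>n. cmod (c n) \<le> m n" "summable m" "\<And>n. norm (a n) \<le> B"
  shows "summable (\<lambda>n. c n *\<^sub>C a n)" "norm (\<Sum>n. c n *\<^sub>C a n) \<le> suminf m * B"
proof -
  have "norm (c n *\<^sub>C a n) \<le> m n * B" for n
    unfolding norm_scaleC using assms(1)[of n] assms(3)[of n]
    by (intro mult_mono) (auto intro: order_trans[OF norm_ge_zero])
  moreover have m: "summable (\<lambda>n. m n * B)" by (rule summable_mult2[OF assms(2)])
  ultimately have "summable (\<lambda>n. norm (c n *\<^sub>C a n))"
    by (intro summable_comparison_test'[OF m]) simp
  thus "summable (\<lambda>n. c n *\<^sub>C a n)" by (rule summable_norm_cancel)
  have "norm (\<Sum>n. c n *\<^sub>C a n) \<le> (\<Sum>n. norm (c n *\<^sub>C a n))"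
    by (rule summable_norm) fact
  also have "\<dots> \<le> (\<Sum>n. m n * B)"
    by (rule suminf_le) fact+
  finally show "norm (\<Sum>n. c n *\<^sub>C a n) \<le> suminf m * B"
    by (simp add: suminf_mult2[OF assms(2)])
qed

definition hardy_deriv :: "complex \<Rightarrow> 'a::chilbert_space hardy \<Rightarrow> 'a" where
  "hardy_deriv z f = (\<Sum>n. (of_nat n * z ^ (n - Suc 0)) *\<^sub>C hardy_coeff f n)"

context
  fixes z assumes z: "z \<in> unit_disc"
begin

lemma
  shows summable_hardy_deriv: "summable (\<lambda>n. (of_nat n * z ^ (n - Suc 0)) *\<^sub>C hardy_coeff f n)"
    and norm_hardy_deriv_le: "norm (hardy_deriv z f) \<le> (\<Sum>n. of_nat n * cmod z ^ (n - Suc 0)) * norm f"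
  using norm_suminf_scaleC_le[of "\<lambda>n. of_nat n * z ^ (n - Suc 0)" "\<lambda>n. of_nat n * cmod z ^ (n - Suc 0)"
      "hardy_coeff f" "norm f"] summable_termdiff2(1)[of "cmod z"] z norm_coeff_le[of f]
  by (auto simp: unit_disc_iff hardy_deriv_def norm_mult norm_power)

lemma hardy_deriv_add: "hardy_deriv z (f + g) = hardy_deriv z f + hardy_deriv z g"
  by (simp add: hardy_deriv_def coeff_add scaleC_add_right suminf_add summable_hardy_deriv)

lemma hardy_deriv_scaleC: "hardy_deriv z (c *\<^sub>C f) = c *\<^sub>C hardy_deriv z f"
  unfolding hardy_deriv_def bounded_linear.suminf[OF bounded_linear_scaleC summable_hardy_deriv]
  by (simp add: coeff_scaleC scaleC_scaleC mult.commute)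

text \<open>Termwise this is the remainder estimate \<open>lemma_termdiff3\<close> for
  \<open>w ^ n\<close>. The constant depends on \<open>K\<close> only and the bound is linear in
  \<open>norm f\<close>, which makes the limit one in operator norm.\<close>

lemma hardy_difference_quotient:
  assumes w: "w \<in> unit_disc" "w \<noteq> z" and K: "cmod z \<le> K" "cmod w \<le> K" "K < 1"
  shows "norm ((1 / (w - z)) *\<^sub>C (hardy_eval f w - hardy_eval f z) - hardy_deriv z f)
    \<le> (\<Sum>n. of_nat n * of_nat (n - Suc 0) * K ^ (n - 2)) * cmod (w - z) * norm f"
proof -
  define c where "c n = (w ^ n - z ^ n) / (w - z) - of_nat n * z ^ (n - Suc 0)" for n
  define m where "m = (\<lambda>n. of_nat n * of_nat (n - Suc 0) * K ^ (n - 2))"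
  have "0 \<le> K" using K(1) norm_ge_zero order_trans by blast
  hence m: "summable m" unfolding m_def using K by (intro summable_termdiff2) simp
  have c: "cmod (c n) \<le> m n * cmod (w - z)" for n
    using lemma_termdiff3[of "w - z" z K n] w K by (simp add: c_def m_def)
  have "(\<lambda>n. c n *\<^sub>C hardy_coeff f n) sums
      ((1 / (w - z)) *\<^sub>C (hardy_eval f w - hardy_eval f z) - hardy_deriv z f)"
  proof -
    have "(\<lambda>n. (1 / (w - z)) *\<^sub>C (w ^ n *\<^sub>C hardy_coeff f n - z ^ n *\<^sub>C hardy_coeff f n)
        - (of_nat n * z ^ (n - Suc 0)) *\<^sub>C hardy_coeff f n) sums
        ((1 / (w - z)) *\<^sub>C (hardy_eval f w - hardy_eval f z) - hardy_deriv z f)"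
      unfolding hardy_deriv_def
      by (intro sums_diff bounded_linear.sums[OF bounded_linear_scaleC] hardy_eval_sums z w
          summable_sums summable_hardy_deriv)
    thus ?thesis by (simp add: c_def scaleC_diff_right scaleC_diff_left scaleC_scaleC diff_divide_distrib)
  qed
  hence "(1 / (w - z)) *\<^sub>C (hardy_eval f w - hardy_eval f z) - hardy_deriv z f
      = (\<Sum>n. c n *\<^sub>C hardy_coeff f n)" by (simp add: sums_iff)
  also have "norm \<dots> \<le> (\<Sum>n. m n * cmod (w - z)) * norm f"
    by (rule norm_suminf_scaleC_le[OF c summable_mult2[OF m] norm_coeff_le])
  also have "(\<Sum>n. m n * cmod (w - z)) = suminf m * cmod (w - z)" by (rule suminf_mult2[OF m, symmetric])
  finally show ?thesis by (simp add: m_def)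
qed

end

text \<open>\<open>op_norm\<close> is a supremum of reals; the zero vector makes the set nonempty
  and \<open>C\<close> bounds it.\<close>

lemma
  assumes "0 \<in> E" "\<And>x. x \<in> E \<Longrightarrow> norm (T x) \<le> C * norm x" "0 \<le> C"
  shows op_norm_le: "op_norm E T \<le> C" and op_norm_nonneg: "0 \<le> op_norm E T"
proof -
  have le: "norm (T x) \<le> C" if "x \<in> {x \<in> E. norm x \<le> 1}" for x
    using assms(2)[of x] that mult_left_mono[OF _ assms(3), of "norm x" 1] by force
  have mem: "0 \<in> {x \<in> E. norm x \<le> 1}" using assms(1) by simp
  show "op_norm E T \<le> C" unfolding op_norm_def using mem le by (intro cSUP_least) auto
  have "norm (T 0) \<le> op_norm E T"
    unfolding op_norm_def using mem le by (intro cSUP_upper bdd_aboveI2) auto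
  thus "0 \<le> op_norm E T" using norm_ge_zero order_trans by blast
qed

lemma op_holomorphic_eval:
  assumes E: "closed_csubspace E" and F: "closed_csubspace F" and EF: "E \<subseteq> H2 F"
  shows "op_holomorphic E F (\<lambda>z f. hardy_eval f z)"
  unfolding op_holomorphic_def
proof
  interpret E: csubspace E using E by unfold_locales
  interpret F: csubspace F using F by unfold_locales
  fix z assume z: "z \<in> unit_disc"
  have D: "hardy_deriv z \<in> bounded_ops E F"
    unfolding bounded_ops_def
  proof (intro CollectI conjI ballI allI exI)
    fix f assume "f \<in> E"
    hence "hardy_coeff f n \<in> F" for n using EF F.H2_iff by blast
    thus "hardy_deriv z f \<in> F"
      unfolding hardy_deriv_def by (intro F.suminf_mem summable_hardy_deriv[OF z]) simp
  qed (rule hardy_deriv_add[OF z] hardy_deriv_scaleC[OF z] norm_hardy_deriv_le[OF z])+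
  \<comment> \<open>The midpoint of \<open>cmod z\<close> and \<open>1\<close>: one constant
    \<open>M\<close> then serves all \<open>w\<close> near \<open>z\<close>, and the series defining
    it converges.\<close>
  define K where "K = (1 + cmod z) / 2"
  have K: "cmod z < K" "K < 1" "0 \<le> K" using z by (auto simp: K_def unit_disc_iff)
  define M where "M = (\<Sum>n. of_nat n * of_nat (n - Suc 0) * K ^ (n - 2))"
  have "0 \<le> M" unfolding M_def using K by (intro suminf_nonneg summable_termdiff2) auto
  have "\<forall>\<^sub>F w in at z. w \<noteq> z \<and> cmod w < K"
  proof -
    have "\<forall>\<^sub>F w in nhds z. cmod w < K"
      using eventually_nhds_in_open[of "ball 0 K" z] K by simp
    thus ?thesis by (auto simp: eventually_at_filter elim: eventually_mono)
  qed
  hence bound: "\<forall>\<^sub>F w in at z.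
      norm (op_norm E (\<lambda>f. (1 / (w - z)) *\<^sub>C (hardy_eval f w - hardy_eval f z) - hardy_deriv z f))
      \<le> M * cmod (w - z)"
  proof eventually_elim
    case (elim w)
    have w: "w \<in> unit_disc" using elim K by (simp add: unit_disc_iff)
    have *: "norm ((1 / (w - z)) *\<^sub>C (hardy_eval f w - hardy_eval f z) - hardy_deriv z f)
        \<le> M * cmod (w - z) * norm f" for f
      unfolding M_def using elim K by (intro hardy_difference_quotient[OF z w]) auto
    have "0 \<le> M * cmod (w - z)" using \<open>0 \<le> M\<close> by simp
    from op_norm_le[OF E.zero_mem * this] op_norm_nonneg[OF E.zero_mem * this] show ?case by simp
  qed
  have "((\<lambda>w. M * cmod (w - z)) \<longlongrightarrow> M * cmod (z - z)) (at z)" by (intro tendsto_intros)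
  hence "((\<lambda>w. M * cmod (w - z)) \<longlongrightarrow> 0) (at z)" by simp
  from Lim_null_comparison[OF bound this] D
  show "\<exists>D\<in>bounded_ops E F. ((\<lambda>w. op_norm E (\<lambda>f. (1 / (w - z)) *\<^sub>C
      (hardy_eval f w - hardy_eval f z) - D f)) \<longlongrightarrow> 0) (at z)" by blast
qed

section \<open>The inner function of a shift-invariant subspace\<close>

text \<open>Pythagoras on finite blocks reduces the Cauchy criterion for \<open>x\<close> to that of
  the squared norms, with \<open>e\<^sup>2\<close> in place of \<open>e\<close>.\<close>

lemma orthogonal_series:
  fixes x :: "nat \<Rightarrow> 'a::{real_inner,banach}"
  assumes orth: "\<And>i j. i < j \<Longrightarrow> inner (x i) (x j) = 0" and s: "(\<lambda>n. (norm (x n))\<^sup>2) sums t"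
  shows "summable x" and "(norm (suminf x))\<^sup>2 = t"
proof -
  have orth': "pairwise (\<lambda>i j. orthogonal (x i) (x j)) I" for I
    unfolding pairwise_def orthogonal_def using orth by (metis inner_commute linorder_neqE_nat)
  have pyth: "(norm (sum x I))\<^sup>2 = (\<Sum>i\<in>I. (norm (x i))\<^sup>2)" if "finite I" for I
    by (rule norm_sum_Pythagorean[OF that orth'])
  have "summable (\<lambda>n. (norm (x n))\<^sup>2)" using s by (simp add: sums_iff)
  note Cauchy = this[unfolded summable_Cauchy, rule_format]
  show x: "summable x"
    unfolding summable_Cauchy
  proof (intro allI impI)
    fix e :: real assume e: "e > 0"
    obtain N where N: "\<And>m n. m \<ge> N \<Longrightarrow> norm (\<Sum>i=m..<n. (norm (x i))\<^sup>2) < e\<^sup>2"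
      using Cauchy[of "e\<^sup>2"] e by auto
    have "norm (sum x {m..<n}) < e" if "m \<ge> N" for m n
    proof -
      have "(norm (sum x {m..<n}))\<^sup>2 < e\<^sup>2"
        using N[OF that, of n] by (simp add: pyth sum_nonneg)
      thus ?thesis using e by (simp add: power2_less_imp_less)
    qed
    thus "\<exists>N. \<forall>m\<ge>N. \<forall>n. norm (sum x {m..<n}) < e" by blast
  qed
  have "(\<lambda>N. (norm (sum x {..<N}))\<^sup>2) \<longlonglongrightarrow> (norm (suminf x))\<^sup>2"
    by (intro tendsto_intros summable_LIMSEQ x)
  moreover have "(\<lambda>N. (norm (sum x {..<N}))\<^sup>2) \<longlonglongrightarrow> t"
    using s by (simp add: pyth sums_def)
  ultimately show "(norm (suminf x))\<^sup>2 = t" by (rule LIMSEQ_unique)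
qed

locale shift_invariant = csubspace S for S :: "'w::chilbert_space hardy set" +
  assumes shift_mem: "f \<in> S \<Longrightarrow> shift f \<in> S"
begin

sublocale isometry S shift
proof unfold_locales
  have "shift (f + g) = shift f + shift g" "shift (c *\<^sub>C f) = c *\<^sub>C shift f" for f g :: "'w hardy" and c
    by (rule hardy_eqI_eval, simp add: eval_shift hardy_eval_add hardy_eval_scaleC scaleC_add_right
        scaleC_scaleC mult.commute)+
  thus "isom shift" by (simp add: isom_def shift_mem norm_shift)
qed

lemma isom_shift_power: "isom (shift ^^ k)"
proof (induction k)
  case 0 thus ?case using isom_id by (simp add: id_def)
next
  case (Suc k) show ?case unfolding funpow.simps by (rule isom_comp[OF isom_V Suc])
qed

lemma coeff_shift_power: "m < k \<Longrightarrow> hardy_coeff ((shift ^^ k) f) m = 0"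
  by (induction k arbitrary: m) (auto simp: coeff_shift split: nat.splits)

lemma eval_shift_power: "hardy_eval ((shift ^^ k) f) z = z ^ k *\<^sub>C hardy_eval f z"
  by (induction k) (simp_all add: eval_shift scaleC_scaleC)

lemma wandering_shift_orth:
  assumes "k < l" "a \<in> wandering" "b \<in> S"
  shows "cinner ((shift ^^ k) a) ((shift ^^ l) b) = 0"
proof -
  obtain d where l: "l = k + Suc d" using assms(1) less_iff_Suc_add by auto
  have "(shift ^^ l) b = (shift ^^ k) (shift ((shift ^^ d) b))" by (simp add: l funpow_add funpow_swap1)
  thus ?thesis
    using assms isom_mem[OF isom_shift_power]
    by (simp add: isom_cinner[OF isom_shift_power] wandering_mem wandering_orth)
qed

lemma wandering_series:
  assumes h: "\<And>k. h k \<in> wandering" and s: "(\<lambda>k. (norm (h k))\<^sup>2) sums t"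
  shows "summable (\<lambda>k. (shift ^^ k) (h k))"
    and "(norm (\<Sum>k. (shift ^^ k) (h k)))\<^sup>2 = t"
proof -
  have "inner ((shift ^^ i) (h i)) ((shift ^^ j) (h j)) = 0" if "i < j" for i j
    using wandering_shift_orth[OF that h wandering_mem[OF h]] by (simp add: inner_eq_Re_cinner)
  moreover have "(\<lambda>k. (norm ((shift ^^ k) (h k)))\<^sup>2) sums t"
    using s h by (simp add: isom_norm[OF isom_shift_power] wandering_mem)
  ultimately show "summable (\<lambda>k. (shift ^^ k) (h k))" "(norm (\<Sum>k. (shift ^^ k) (h k)))\<^sup>2 = t"
    using orthogonal_series[of "\<lambda>k. (shift ^^ k) (h k)"] by blast+
qed

text \<open>Multiplication by \<open>\<Theta>\<close> in series form. The coefficients of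
  \<open>h\<close> are themselves functions, and the value of the sum at \<open>z\<close> is
  \<open>h(z)\<close> evaluated at \<open>z\<close>. Isometry and range are read off from the
  series.\<close>

definition synth :: "'w hardy hardy \<Rightarrow> 'w hardy" where
  "synth h = (\<Sum>k. (shift ^^ k) (hardy_coeff h k))"

context
  fixes h assumes h: "h \<in> H2 wandering"
begin

lemma coeff_wandering: "hardy_coeff h k \<in> wandering"
  using h wand.H2_iff by blast

lemmas synth_series = wandering_series[OF coeff_wandering hardy_norm_sums]

lemma synth_mem: "synth h \<in> S"
  unfolding synth_def using coeff_wandering
  by (intro suminf_mem synth_series(1) isom_mem[OF isom_shift_power] wandering_mem)

lemma norm_synth: "norm (synth h) = norm h"
  using synth_series(2) by (simp add: synth_def power2_eq_iff_nonneg)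

lemma eval_synth:
  assumes z: "z \<in> unit_disc"
  shows "hardy_eval (synth h) z = hardy_eval (hardy_eval h z) z"
proof -
  have "(\<lambda>k. hardy_eval ((shift ^^ k) (hardy_coeff h k)) z) sums hardy_eval (synth h) z"
    unfolding synth_def
    by (intro bounded_linear.sums[OF bounded_linear_eval[OF z]] summable_sums synth_series(1))
  moreover have "(\<lambda>k. hardy_eval (z ^ k *\<^sub>C hardy_coeff h k) z) sums hardy_eval (hardy_eval h z) z"
    by (intro bounded_linear.sums[OF bounded_linear_eval[OF z]] hardy_eval_sums z)
  ultimately show ?thesis by (intro sums_unique2) (simp_all add: eval_shift_power hardy_eval_scaleC)
qed

lemma mult_eval_eq_synth: "mult_op (\<lambda>z f. hardy_eval f z) h = synth h"
  by (rule mult_op_eqI) (rule eval_synth)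

end

text \<open>The Wold decomposition has no unitary part: a vector in the range of \<open>shift ^^ N\<close> has its
  first \<open>N\<close> coefficients equal to zero.\<close>

lemma synth_surj:
  assumes f: "f \<in> S"
  shows "\<exists>h\<in>H2 wandering. synth h = f"
proof -
  \<comment> \<open>\<open>r k\<close> is what remains of \<open>f\<close> after removing
    \<open>k\<close> shifts; its wandering component \<open>h k\<close> is the candidate
    coefficient.\<close>
  define r where "r k = (V_adj ^^ k) f" for k
  have r: "r k \<in> S" for k by (induction k) (simp_all add: r_def f)
  define h where "h k = r k - shift (r (Suc k))" for k
  have hw: "h k \<in> wandering" for k using residual_wandering[OF r, of k] by (simp add: h_def r_def)
  have rem: "f = (\<Sum>k<N. (shift ^^ k) (h k)) + (shift ^^ N) (r N)" for N
  proof (induction N)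
    case (Suc N)
    have "(shift ^^ N) (r N) = (shift ^^ N) (h N) + (shift ^^ N) (shift (r (Suc N)))"
      using isom_add[OF isom_shift_power[of N] wandering_mem[OF hw[of N]] V_mem[OF r[of "Suc N"]]]
      by (simp add: h_def)
    thus ?case using Suc by (simp add: funpow_swap1 add.assoc)
  qed (simp add: r_def)
  have norm_r: "(norm (r k))\<^sup>2 = (norm (h k))\<^sup>2 + (norm (r (Suc k)))\<^sup>2" for k
  proof -
    have "inner (h k) (shift (r (Suc k))) = 0"
      using wandering_orth[OF hw r] by (simp add: inner_eq_Re_cinner)
    hence "(norm (h k + shift (r (Suc k))))\<^sup>2 = (norm (h k))\<^sup>2 + (norm (shift (r (Suc k))))\<^sup>2"
      by (simp add: norm_add_Pythagorean orthogonal_def)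
    thus ?thesis by (simp add: h_def norm_shift)
  qed
  have "(\<Sum>k<N. (norm (h k))\<^sup>2) = (norm f)\<^sup>2 - (norm (r N))\<^sup>2" for N
  proof (induction N)
    case 0 show ?case by (simp add: r_def)
  next
    case (Suc N) thus ?case using norm_r[of N] by simp
  qed
  hence "(\<Sum>k<N. (norm (h k))\<^sup>2) \<le> (norm f)\<^sup>2" for N by simp
  hence "square_summable h"
    unfolding square_summable_def by (intro summableI_nonneg_bounded) auto
  then obtain g where g: "hardy_coeff g = h" using ex_hardy_coeff by blast
  have gH: "g \<in> H2 wandering" using wand.H2_iff hw g by metis
  have "synth g = f"
  proof (rule hardy_eqI)
    fix m
    have "(\<lambda>N. \<Sum>k<N. (shift ^^ k) (h k)) \<longlonglongrightarrow> synth g"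
      unfolding synth_def g using synth_series(1)[OF gH] by (intro summable_LIMSEQ) (simp add: g)
    from bounded_linear.tendsto[OF bounded_linear_coeff this]
    have lim: "(\<lambda>N. hardy_coeff (\<Sum>k<N. (shift ^^ k) (h k)) m) \<longlonglongrightarrow> hardy_coeff (synth g) m" .
    have "\<forall>\<^sub>F N in sequentially. hardy_coeff (\<Sum>k<N. (shift ^^ k) (h k)) m = hardy_coeff f m"
      using eventually_gt_at_top[of m]
    proof eventually_elim
      case (elim N)
      thus ?case by (subst rem[of N]) (simp add: coeff_add coeff_shift_power)
    qed
    from LIMSEQ_unique[OF lim tendsto_eventually[OF this]]
    show "hardy_coeff (synth g) m = hardy_coeff f m" .
  qed
  thus ?thesis using gH by blast
qed

lemma range_eval: "mult_op (\<lambda>z f. hardy_eval f z) ` H2 wandering = S"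
  using synth_surj synth_mem mult_eval_eq_synth by (auto simp: image_iff)

text \<open>Testing the isometry on a kernel function at \<open>z\<close> gives a bound that is uniform in \<open>z\<close>.\<close>

lemma norm_eval_wandering_le:
  assumes x: "x \<in> wandering" and z: "z \<in> unit_disc"
  shows "norm (hardy_eval x z) \<le> norm x"
proof -
  define h where "h = kern z x"
  have h: "h \<in> H2 wandering" unfolding wand.H2_iff h_def using x by (simp add: kern_coeff[OF z])
  define r where "r = 1 - (cmod z)\<^sup>2"
  have r: "r > 0" using sq_less_1[OF z] by (simp add: r_def)
  have "hardy_eval (synth h) z = (1 / r) *\<^sub>R hardy_eval x z"
    unfolding eval_synth[OF h z] by (simp add: h_def eval_kern[OF z] r_def scaleR_scaleC hardy_eval_scaleC)
  hence "(norm (hardy_eval (synth h) z))\<^sup>2 = (norm (hardy_eval x z))\<^sup>2 / r\<^sup>2"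
    using r by (simp add: power_divide)
  \<comment> \<open>Both the value at \<open>z\<close> and the squared norm of the kernel carry a
    factor \<open>1 / r\<close>. These cancel exactly against \<open>r\<close>, so the bound is
    \<open>1\<close> for every \<open>z\<close>.\<close>
  moreover have "r * (norm (hardy_eval (synth h) z))\<^sup>2 \<le> (norm x)\<^sup>2 / r"
    using norm_eval_le[OF z, of "synth h"] norm_kern[OF z, of x, folded h_def r_def]
    by (simp add: norm_synth[OF h] flip: r_def)
  ultimately have "(norm (hardy_eval x z))\<^sup>2 \<le> (norm x)\<^sup>2"
    using r by (simp add: power2_eq_square field_simps)
  thus ?thesis by (rule power2_le_imp_le) simp
qed

lemma inner_function_eval:
  assumes W: "closed_csubspace W" and SW: "S \<subseteq> H2 W"
  shows "inner_function wandering W (\<lambda>z f. hardy_eval f z)"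
  unfolding inner_function_def Hinf_def
proof (intro conjI CollectI ballI)
  have EW: "wandering \<subseteq> H2 W" using SW wandering_mem by blast
  show "op_holomorphic wandering W (\<lambda>z f. hardy_eval f z)"
    by (rule op_holomorphic_eval[OF wand.closed_csubspace W EW])
  have le: "norm (hardy_eval x z) \<le> 1 * norm x" if "x \<in> wandering" "z \<in> unit_disc" for x z
    using norm_eval_wandering_le[OF that] by simp
  show "(\<lambda>f. hardy_eval f z) \<in> bounded_ops wandering W" if "z \<in> unit_disc" for z
    unfolding bounded_ops_def using EW that le
    by (auto simp: H2_def hardy_eval_add hardy_eval_scaleC intro!: exI[of _ 1])
  show "\<exists>K. \<forall>z\<in>unit_disc. op_norm wandering (\<lambda>f. hardy_eval f z) \<le> K"
    using le by (intro exI[of _ 1] ballI op_norm_le) auto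
  show "\<exists>g\<in>H2 W. (\<forall>z\<in>unit_disc. hardy_eval g z = hardy_eval (hardy_eval h z) z) \<and> norm g = norm h"
    if "h \<in> H2 wandering" for h
    using synth_mem[OF that] SW eval_synth[OF that] norm_synth[OF that]
    by (intro bexI[of _ "synth h"]) auto
qed

end

section \<open>Invariant subspaces\<close>

lemma (in model_tuple) invariant_imp_representation:
  assumes S: "closed_csubspace S" "S \<subseteq> H2 W"
    and inv: "\<And>i. i \<in> {1..n} \<Longrightarrow> mult_op (\<Phi> i) ` S \<subseteq> S"
  shows "\<exists>E \<Theta> \<Psi>. closed_csubspace E \<and> inner_function E W \<Theta> \<and> model_isometry n E \<Psi> \<and>
    S = mult_op \<Theta> ` H2 E \<and>
    (\<forall>j\<in>{1..n}. \<forall>z\<in>unit_disc. \<forall>x\<in>E. \<Phi> j z (\<Theta> z x) = \<Theta> z (\<Psi> j z (x :: 'w hardy)))"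
proof -
  interpret S: csubspace S using S(1) by unfold_locales
  note inS = inv[unfolded image_subset_iff, rule_format]
  have prod: "op_prod (map (\<lambda>i. mult_op (\<Phi> i)) [1..<n+1]) f = shift f" if "f \<in> S" for f
    using that S(2) by (intro mult_prod) auto
  interpret shift_invariant S
  proof
    fix f assume f: "f \<in> S"
    have "op_prod (map (\<lambda>i. mult_op (\<Phi> i)) [1..<n+1]) f \<in> S"
      by (rule op_prod_mem[where I = "{1..n}"]) (use f inS in auto)
    thus "shift f \<in> S" using prod[OF f] by simp
  qed
  interpret commuting_isometries S shift n "\<lambda>i. mult_op (\<Phi> i)"
  proof
    show "S.isom (mult_op (\<Phi> i))" if "i \<in> {1..n}" for i
      using mult_isom[OF that S.csubspace_axioms S(2) inv[OF that]] .
  qed (use mult_commute S(2) prod in auto)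
  let ?\<Psi> = "\<lambda>i z w. unit (mult_op (\<Phi> i)) ((w - prj (mult_op (\<Phi> i)) w) + z *\<^sub>C prj (mult_op (\<Phi> i)) w)"
  have "\<Phi> j z (hardy_eval x z) = hardy_eval (?\<Psi> j z x) z"
    if j: "j \<in> {1..n}" and z: "z \<in> unit_disc" and x: "x \<in> wandering" for j z x
  proof -
    define R where "R = mult_op (\<Phi> j)"
    have R: "divisor R" using divisor_T[OF j] by (simp add: R_def)
    have p: "prj R x \<in> S" "x - prj R x \<in> S"
      using prj_wandering[OF R x] x by (auto simp: wandering_mem)
    have "\<Phi> j z (hardy_eval x z) = hardy_eval (R x) z"
      using j z x S(2) wandering_mem unfolding R_def by (intro eval_mult[symmetric]) auto
    also have "R x = unit R (x - prj R x) + shift (unit R (prj R x))"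
      using T_eq_symbol[OF j x] by (simp add: R_def)
    \<comment> \<open>Evaluation at \<open>z\<close> turns \<open>shift\<close> into the scalar
      \<open>z\<close>, so the two terms merge into the value of one wandering vector.\<close>
    also have "hardy_eval \<dots> z = hardy_eval (unit R ((x - prj R x) + z *\<^sub>C prj R x)) z"
      using p by (simp add: hardy_eval_add eval_shift hardy_eval_scaleC unit_add[OF R] unit_scaleC[OF R])
    finally show ?thesis by (simp add: R_def)
  qed
  thus ?thesis
    using wand.closed_csubspace inner_function_eval[OF closed_csubspace S(2)]
      model_isometry_wandering range_eval[symmetric]
    by (intro exI[of _ wandering] exI[of _ "\<lambda>z f. hardy_eval f z"] exI[of _ ?\<Psi>]) blast
qed

text \<open>The intertwining gives \<open>\<Phi> i (\<Theta> h) = \<Theta> (\<Psi> i h)\<close>, and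
  \<open>\<Psi> i h\<close> is again in \<open>H2 E\<close>. The type \<open>'v\<close> stays open
  to serve both converse claims of the theorem.\<close>

lemma (in model_tuple) representation_imp_invariant:
  fixes E :: "'v::chilbert_space set"
  assumes E: "closed_csubspace E" and \<Theta>: "inner_function E W \<Theta>" and \<Psi>: "model_isometry n E \<Psi>"
    and S: "S = mult_op \<Theta> ` H2 E"
    and intertwine: "\<And>j z x. j \<in> {1..n} \<Longrightarrow> z \<in> unit_disc \<Longrightarrow> x \<in> E \<Longrightarrow> \<Phi> j z (\<Theta> z x) = \<Theta> z (\<Psi> j z x)"
    and i: "i \<in> {1..n}"
  shows "mult_op (\<Phi> i) ` S \<subseteq> S"
proof safe
  obtain U' P' where "model_tuple E n U' P' \<Psi>" using \<Psi> model_isometry_iff[OF E] by blast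
  then interpret E: model_tuple E n U' P' \<Psi> .
  fix f assume "f \<in> S"
  then obtain h where h: "h \<in> H2 E" "f = mult_op \<Theta> h" using S by blast
  have ex: "\<exists>g\<in>H2 W. \<forall>z\<in>unit_disc. hardy_eval g z = \<Theta> z (hardy_eval k z)" if "k \<in> H2 E" for k
    using \<Theta> that by (auto simp: inner_function_def)
  have eval: "mult_op \<Theta> k \<in> H2 W \<and> (\<forall>z\<in>unit_disc. hardy_eval (mult_op \<Theta> k) z = \<Theta> z (hardy_eval k z))"
    if "k \<in> H2 E" for k
    using ex[OF that] mult_op_eqI[of _ \<Theta> k] by metis
  define k where "k = mult_op (\<Psi> i) h"
  have k: "k \<in> H2 E" unfolding k_def by (rule E.mult_mem[OF i h(1)])
  have "mult_op (\<Phi> i) f = mult_op \<Theta> k"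
  proof (rule mult_op_eqI)
    fix z assume z: "z \<in> unit_disc"
    have "hardy_eval h z \<in> E" using h(1) z by (simp add: H2_def)
    thus "hardy_eval (mult_op \<Theta> k) z = \<Phi> i z (hardy_eval f z)"
      using eval[OF k] eval[OF h(1)] z E.eval_mult[OF i h(1) z] intertwine[OF i z]
      by (simp add: h(2) k_def)
  qed
  thus "mult_op (\<Phi> i) f \<in> S" using k S by blast
qed

text \<open>An existential over Hilbert spaces has to fix a type. The first conjunct uses
  \<open>'w hardy\<close>, where the wandering subspace lives; the second gives the converse for
  model spaces in any type.\<close>

theorem theorem4p1:
  fixes n :: nat
    and W :: "'w::chilbert_space set"
    and \<Phi> :: "nat \<Rightarrow> complex \<Rightarrow> 'w \<Rightarrow> 'w"
    and S :: "'w hardy set"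
  assumes "n \<ge> 2"
    and "closed_csubspace W"
    and "model_isometry n W \<Phi>"
    and "closed_csubspace S" and "S \<subseteq> H2 W"
  shows "((\<forall>i\<in>{1..n}. mult_op (\<Phi> i) ` S \<subseteq> S) \<longleftrightarrow>
      (\<exists>(Ws :: 'w hardy set) \<Theta> \<Psi>.
         closed_csubspace Ws \<and> inner_function Ws W \<Theta> \<and> model_isometry n Ws \<Psi> \<and>
         S = mult_op \<Theta> ` H2 Ws \<and>
         (\<forall>j\<in>{1..n}. \<forall>z\<in>unit_disc. \<forall>x\<in>Ws. \<Phi> j z (\<Theta> z x) = \<Theta> z (\<Psi> j z x))))
    \<and>
      (\<forall>(Ws :: 'v::chilbert_space set) \<Theta> \<Psi>.
         closed_csubspace Ws \<and> inner_function Ws W \<Theta> \<and> model_isometry n Ws \<Psi> \<and>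
         S = mult_op \<Theta> ` H2 Ws \<and>
         (\<forall>j\<in>{1..n}. \<forall>z\<in>unit_disc. \<forall>x\<in>Ws. \<Phi> j z (\<Theta> z x) = \<Theta> z (\<Psi> j z x))
         \<longrightarrow> (\<forall>i\<in>{1..n}. mult_op (\<Phi> i) ` S \<subseteq> S))"
proof -
  obtain U P where "model_tuple W n U P \<Phi>"
    using assms(3) model_isometry_iff[OF assms(2)] by blast
  then interpret model_tuple W n U P \<Phi> .
  show ?thesis
  proof (intro conjI iffI allI impI ballI)
    assume "\<forall>i\<in>{1..n}. mult_op (\<Phi> i) ` S \<subseteq> S"
    thus "\<exists>(Ws :: 'w hardy set) \<Theta> \<Psi>.
         closed_csubspace Ws \<and> inner_function Ws W \<Theta> \<and> model_isometry n Ws \<Psi> \<and>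
         S = mult_op \<Theta> ` H2 Ws \<and>
         (\<forall>j\<in>{1..n}. \<forall>z\<in>unit_disc. \<forall>x\<in>Ws. \<Phi> j z (\<Theta> z x) = \<Theta> z (\<Psi> j z x))"
      using invariant_imp_representation[OF assms(4,5)] by blast
  qed (use representation_imp_invariant in blast)+
qed

end
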